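(* There exist a simply connected, complete, parabolic surface $Y$ of nowhere positive curvature, a point $a\in Y$, and a constant $\epsilon>0$ such that for every $r>0$ $$\int_{D(a,r)}\text{curvature}<-\epsilon\,\operatorname{area}\bigl(D(a,r)\bigr),$$ where $D(a,r)$ denotes the open disc in $Y$ centered at $a$ of radius $r$.
   Context: "Surface" here is understood in the sense of surfaces of bounded curvature (Aleksandrov surfaces): a Riemann surface with a length metric given in local coordinates by a conformal length element $\rho(z)|dz|$, whose curvature is a signed measure. For $\rho$ positive and continuous, the area measure is $\rho^2\,dx\,dy$ and the curvature measure is $-\Delta\log\rho$ in the sense of distributions; where $\rho$ is smooth this is the Gaussian curvature $-\rho^{-2}\Delta\log\rho$ times the area measure. The expression $\int_{D(a,r)}\text{curvature}$ is the curvature measure of $D(a,r)$. "Nowhere positive curvature" means that the curvature measure is non-positive. "Complete" means complete as a metric space. "Parabolic" means (for a simply connected surface) that the underlying Riemann surface is conformally equivalent to $\mathbb C$. *)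

theory Defs
  imports "HOL-Analysis.Analysis"
begin

section \<open>Riemann surfaces with a conformal length element\<close>

type_synonym 'a chart = "'a set \<times> ('a \<Rightarrow> complex)"

text \<open>
  A chart is a pair \<open>(U, \<phi>)\<close> with \<open>U\<close> its domain; only the restriction of \<open>\<phi>\<close> to \<open>U\<close> matters.
  The number \<open>density S c z\<close> is the value at \<open>z\<close>, a point of the image of the chart \<open>c\<close>, of the
  function \<open>\<rho>\<close> in the local expression \<open>\<rho>(z) |dz|\<close> of the length element.  The surface carries the
  subspace topology of the (Hausdorff) type of its points.
\<close>

record 'a surface =
  points :: "'a set"
  atlas :: "'a chart set"
  density :: "'a chart \<Rightarrow> complex \<Rightarrow> real"

definition transition :: "'a chart \<Rightarrow> 'a chart \<Rightarrow> complex \<Rightarrow> complex" where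
  "transition c c' = snd c' \<circ> inv_into (fst c) (snd c)"

definition riemann_surface :: "('a::t2_space, 'b) surface_scheme \<Rightarrow> bool" where
  "riemann_surface S \<longleftrightarrow>
     points S \<noteq> {} \<and> connected (points S) \<and> (\<Union>c\<in>atlas S. fst c) = points S \<and>
     (\<forall>(U, \<phi>)\<in>atlas S. openin (top_of_set (points S)) U \<and> open (\<phi> ` U) \<and>
        homeomorphism U (\<phi> ` U) \<phi> (inv_into U \<phi>)) \<and>
     (\<forall>c\<in>atlas S. \<forall>c'\<in>atlas S.
        transition c c' holomorphic_on snd c ` (fst c \<inter> fst c'))"

definition conformal_length_element :: "('a::t2_space, 'b) surface_scheme \<Rightarrow> bool" where
  "conformal_length_element S \<longleftrightarrow>
     (\<forall>c\<in>atlas S. continuous_on (snd c ` fst c) (density S c) \<and>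
        (\<forall>z\<in>snd c ` fst c. density S c z > 0)) \<and>
     (\<forall>c\<in>atlas S. \<forall>c'\<in>atlas S. \<forall>z\<in>snd c ` (fst c \<inter> fst c').
        density S c z = density S c' (transition c c' z) * cmod (deriv (transition c c') z))"

definition conformal_to_plane :: "('a::t2_space, 'b) surface_scheme \<Rightarrow> bool" where
  "conformal_to_plane S \<longleftrightarrow>
     (\<exists>f g. homeomorphism (points S) (UNIV :: complex set) f g \<and>
        (\<forall>(U, \<phi>)\<in>atlas S. (f \<circ> inv_into U \<phi>) holomorphic_on \<phi> ` U \<and>
                         (\<phi> \<circ> g) holomorphic_on f ` U))"

definition parabolic :: "('a::t2_space, 'b) surface_scheme \<Rightarrow> bool" where
  "parabolic S \<longleftrightarrow> simply_connected (points S) \<and> conformal_to_plane S"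

section \<open>The length metric\<close>

definition piecewise_C1_path :: "('a::t2_space, 'b) surface_scheme \<Rightarrow> (real \<Rightarrow> 'a) \<Rightarrow> bool" where
  "piecewise_C1_path S \<gamma> \<longleftrightarrow> path \<gamma> \<and> path_image \<gamma> \<subseteq> points S \<and>
     (\<exists>T. finite T \<and> (\<forall>(U, \<phi>)\<in>atlas S. (\<phi> \<circ> \<gamma>) C1_differentiable_on (({0..1} - T) \<inter> \<gamma> -` U)))"

text \<open>
  Outside the finitely many exceptional parameters the speed does not depend on the chosen chart,
  by the transformation rule of the density.
\<close>

definition speed :: "('a::t2_space, 'b) surface_scheme \<Rightarrow> (real \<Rightarrow> 'a) \<Rightarrow> real \<Rightarrow> real" where
  "speed S \<gamma> t =
     (let c = (SOME c. c \<in> atlas S \<and> \<gamma> t \<in> fst c)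
      in density S c (snd c (\<gamma> t)) * norm (vector_derivative (snd c \<circ> \<gamma>) (at t)))"

definition path_length :: "('a::t2_space, 'b) surface_scheme \<Rightarrow> (real \<Rightarrow> 'a) \<Rightarrow> ennreal" where
  "path_length S \<gamma> = (\<integral>\<^sup>+ t \<in> {0..1}. ennreal (speed S \<gamma> t) \<partial>lborel)"

definition length_dist :: "('a::t2_space, 'b) surface_scheme \<Rightarrow> 'a \<Rightarrow> 'a \<Rightarrow> real" where
  "length_dist S p q =
     enn2real (INF \<gamma> \<in> {\<gamma>. piecewise_C1_path S \<gamma> \<and> pathstart \<gamma> = p \<and> pathfinish \<gamma> = q}.
       path_length S \<gamma>)"

definition complete_surface :: "('a::t2_space, 'b) surface_scheme \<Rightarrow> bool" where
  "complete_surface S \<longleftrightarrow>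
     Metric_space (points S) (length_dist S) \<and>
     Metric_space.mcomplete (points S) (length_dist S)"

definition disc :: "('a::t2_space, 'b) surface_scheme \<Rightarrow> 'a \<Rightarrow> real \<Rightarrow> 'a set" where
  "disc S a r = Metric_space.mball (points S) (length_dist S) a r"

section \<open>Area and curvature\<close>

definition radon_measure_on :: "'a::t2_space set \<Rightarrow> 'a measure \<Rightarrow> bool" where
  "radon_measure_on Y M \<longleftrightarrow> sets M = sets (restrict_space borel Y) \<and>
     (\<forall>C. compact C \<and> C \<subseteq> Y \<longrightarrow> emeasure M C < \<infinity>)"

text \<open>The next property determines the measure, since a Riemann surface has a countable base.\<close>

definition area_measure :: "('a::t2_space, 'b) surface_scheme \<Rightarrow> 'a measure \<Rightarrow> bool" where
  "area_measure S M \<longleftrightarrow> radon_measure_on (points S) M \<and>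
     (\<forall>c\<in>atlas S. \<forall>A\<in>sets M. A \<subseteq> fst c \<longrightarrow>
        emeasure M A = (\<integral>\<^sup>+ z \<in> snd c ` A. ennreal ((density S c z)\<^sup>2) \<partial>lborel))"

definition partial_x :: "(complex \<Rightarrow> real) \<Rightarrow> complex \<Rightarrow> real" where
  "partial_x f z = deriv (\<lambda>t::real. f (z + of_real t)) 0"

definition partial_y :: "(complex \<Rightarrow> real) \<Rightarrow> complex \<Rightarrow> real" where
  "partial_y f z = deriv (\<lambda>t::real. f (z + \<i> * of_real t)) 0"

definition laplacian :: "(complex \<Rightarrow> real) \<Rightarrow> complex \<Rightarrow> real" where
  "laplacian f z = partial_x (partial_x f) z + partial_y (partial_y f) z"

primrec C_k :: "nat \<Rightarrow> (complex \<Rightarrow> real) \<Rightarrow> bool" where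
  "C_k 0 f \<longleftrightarrow> continuous_on UNIV f"
| "C_k (Suc k) f \<longleftrightarrow> (\<forall>z. f differentiable (at z)) \<and> C_k k (partial_x f) \<and> C_k k (partial_y f)"

definition test_function :: "complex set \<Rightarrow> (complex \<Rightarrow> real) \<Rightarrow> bool" where
  "test_function \<Omega> g \<longleftrightarrow> (\<forall>k. C_k k g) \<and> (\<exists>C. compact C \<and> C \<subseteq> \<Omega> \<and> (\<forall>z. z \<notin> C \<longrightarrow> g z = 0))"

text \<open>
  On a non-compact surface a signed measure is only locally finite, so both its positive and its
  negative part may be infinite on the whole surface.  It is therefore represented by a pair of
  Radon measures, standing for their difference, which is a number on each Borel set contained in
  a compact set.  Two pairs are the same signed measure iff these numbers agree; a pair need not be
  a Jordan decomposition.
\<close>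

type_synonym 'a signed_measure = "'a measure \<times> 'a measure"

definition signed_value :: "'a signed_measure \<Rightarrow> 'a set \<Rightarrow> real" where
  "signed_value \<kappa> A = measure (fst \<kappa>) A - measure (snd \<kappa>) A"

definition signed_integral :: "'a signed_measure \<Rightarrow> 'a set \<Rightarrow> ('a \<Rightarrow> real) \<Rightarrow> real" where
  "signed_integral \<kappa> A f = (LINT p:A|fst \<kappa>. f p) - (LINT p:A|snd \<kappa>. f p)"

definition nonpositive_on :: "'a::t2_space set \<Rightarrow> 'a signed_measure \<Rightarrow> bool" where
  "nonpositive_on Y \<kappa> \<longleftrightarrow>
     (\<forall>A C. A \<in> sets (restrict_space borel Y) \<and> A \<subseteq> C \<and> compact C \<and> C \<subseteq> Y \<longrightarrow>
        signed_value \<kappa> A \<le> 0)"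

text \<open>In every chart the curvature is \<open>- \<Delta> log \<rho>\<close> in the sense of distributions.\<close>

definition curvature_measure ::
    "('a::t2_space, 'b) surface_scheme \<Rightarrow> 'a signed_measure \<Rightarrow> bool" where
  "curvature_measure S \<kappa> \<longleftrightarrow>
     radon_measure_on (points S) (fst \<kappa>) \<and> radon_measure_on (points S) (snd \<kappa>) \<and>
     (\<forall>c\<in>atlas S. \<forall>g. test_function (snd c ` fst c) g \<longrightarrow>
        signed_integral \<kappa> (fst c) (\<lambda>p. g (snd c p)) =
        - (LINT z|lborel. ln (density S c z) * laplacian g z))"

end

theory Submission
  imports Defs
begin

text \<open>
  On \<open>\<complex>\<close> take \<open>\<rho> = exp (2 \<bar>x\<bar>) / \<bar>1 + \<bar>x\<bar> + i y\<bar>\<close>.  Its logarithm is harmonic off the imaginary axis, and the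
  jump of its normal derivative makes the curvature a negative measure on the axis whose density
  lies between \<open>-4\<close> and \<open>-2\<close>.  On the axis \<open>\<rho> = 1 / sqrt (1 + y\<^sup>2)\<close>, so the disc of radius \<open>r\<close> about \<open>0\<close> meets it in
  \<open>\<bar>y\<bar> < sinh r\<close> and has curvature at most \<open>-4 sinh r\<close>.  For the area, the function
  \<open>\<bar>arsinh y\<bar> + (cosh (2 x) - 1) / (8 sqrt (1 + x\<^sup>2 + y\<^sup>2))\<close> bounds the distance to \<open>0\<close> from below.  Hence
  \<open>\<rho> \<le> 2 + 16 s\<close> on the part of the disc at height \<open>y\<close>, where \<open>s = r - arsinh \<bar>y\<bar>\<close>, and as \<open>\<rho>\<^sup>2\<close> grows
  exponentially in \<open>\<bar>x\<bar>\<close>, that slice has area \<open>O((1 + s)\<^sup>2)\<close>.  Since \<open>(1 + s)\<^sup>2 = O(exp (s / 2))\<close>, integration over \<open>y\<close>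
  gives an area \<open>O(sinh r)\<close>.
\<close>

section \<open>Conformal metrics on the plane\<close>

text \<open>With a single global chart every compatibility condition on the atlas concerns only the
  identity map.\<close>

definition conformal_plane :: "(complex \<Rightarrow> real) \<Rightarrow> complex surface" where
  "conformal_plane \<rho> = \<lparr>points = UNIV, atlas = {(UNIV, id)}, density = (\<lambda>_. \<rho>)\<rparr>"

lemma inv_into_UNIV_id [simp]: "inv_into UNIV id = (id :: complex \<Rightarrow> complex)"
  by (auto simp: fun_eq_iff intro: inv_into_f_eq[of id UNIV])

lemma AE_not_in_finite: "finite (T :: real set) \<Longrightarrow> AE t in lborel. t \<notin> T"
  by (rule AE_not_in[OF finite_imp_null_set_lborel])

locale plane_length_element =
  fixes \<rho> :: "complex \<Rightarrow> real"
  assumes continuous: "continuous_on UNIV \<rho>" and positive: "\<rho> z > 0"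
begin

lemma conformal_plane_simps [simp]:
  "points (conformal_plane \<rho>) = UNIV" "atlas (conformal_plane \<rho>) = {(UNIV, id)}"
  "density (conformal_plane \<rho>) c = \<rho>"
  by (simp_all add: conformal_plane_def)

lemma riemann_surface_plane: "riemann_surface (conformal_plane \<rho>)"
  by (simp add: riemann_surface_def transition_def homeomorphism_def connected_UNIV)

lemma conformal_length_element_plane: "conformal_length_element (conformal_plane \<rho>)"
  using continuous positive
  by (simp add: conformal_length_element_def transition_def)

lemma parabolic_plane: "parabolic (conformal_plane \<rho>)"
  unfolding parabolic_def conformal_to_plane_def
  by (auto simp: convex_imp_simply_connected homeomorphism_def intro!: exI[of _ id])

section \<open>Speed and length of paths\<close>

definition metric_speed :: "(real \<Rightarrow> complex) \<Rightarrow> real \<Rightarrow> real" where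
  "metric_speed \<gamma> t = \<rho> (\<gamma> t) * norm (vector_derivative \<gamma> (at t))"

lemma metric_speed_nonneg [simp]: "metric_speed \<gamma> t \<ge> 0"
  unfolding metric_speed_def using positive[of "\<gamma> t"] by simp

text \<open>The atlas has one chart, so the choice made in \<open>speed\<close> can only return the
  identity chart.\<close>

lemma path_length_plane:
  "path_length (conformal_plane \<rho>) \<gamma> = (\<integral>\<^sup>+t\<in>{0..1}. ennreal (metric_speed \<gamma> t) \<partial>lborel)"
  by (simp add: path_length_def speed_def metric_speed_def cong: conj_cong)

lemma piecewise_C1_path_plane: "piecewise_C1_path (conformal_plane \<rho>) \<gamma> \<longleftrightarrow> valid_path \<gamma>"
  by (simp add: piecewise_C1_path_def valid_path_def piecewise_C1_differentiable_on_def path_def)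

text \<open>The speed is continuous off a finite set, and its values at the exceptional parameters,
  where the path may have no derivative, cannot spoil measurability.\<close>

lemma metric_speed_measurable:
  assumes "valid_path \<gamma>"
  shows "(\<lambda>t. ennreal (metric_speed \<gamma> t) * indicator {0..1} t) \<in> borel_measurable borel"
proof -
  obtain T where T: "finite T" "\<gamma> C1_differentiable_on ({0..1} - T)" and c: "continuous_on {0..1} \<gamma>"
    using assms by (auto simp: valid_path_def piecewise_C1_differentiable_on_def)
  let ?S = "{0..1} - T"
  have "continuous_on ?S \<gamma>"
    using c by (rule continuous_on_subset) auto
  then have "continuous_on ?S (metric_speed \<gamma>)"
    unfolding metric_speed_def using T(2)
    by (intro continuous_intros continuous_on_compose2[OF continuous])
       (auto simp: C1_differentiable_on_eq)
  then have "(\<lambda>t. indicator ?S t *\<^sub>R metric_speed \<gamma> t) \<in> borel_measurable borel"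
    using T(1)
    by (intro borel_measurable_continuous_on_indicator sets.Diff) (auto intro: borel_closed finite_imp_closed)
  then have "(\<lambda>t. ennreal (indicator ?S t *\<^sub>R metric_speed \<gamma> t)) \<in> borel_measurable borel"
    by simp
  then show ?thesis
  proof (rule measurable_discrete_difference[where X = T])
    show "countable T" using T(1) by (rule countable_finite)
  qed (auto simp: indicator_def)
qed

abbreviation "plane_length \<gamma> \<equiv> path_length (conformal_plane \<rho>) \<gamma>"

lemma plane_length_reversepath:
  assumes "valid_path \<gamma>"
  shows "plane_length (reversepath \<gamma>) = plane_length \<gamma>"
proof -
  obtain T where T: "finite T" "\<And>t. t \<in> {0..1} - T \<Longrightarrow> \<gamma> differentiable at t"
    using assms by (auto simp: valid_path_def piecewise_C1_differentiable_on_def C1_differentiable_on_eq)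
  define f where "f = (\<lambda>t. ennreal (metric_speed \<gamma> t) * indicator {0..1} t)"
  have "metric_speed (reversepath \<gamma>) t = metric_speed \<gamma> (1 - t)" if "t \<in> {0..1}" "1 - t \<notin> T" for t
  proof -
    have "(\<gamma> has_vector_derivative vector_derivative \<gamma> (at (1 - t))) (at (1 - t))"
      using T(2)[of "1 - t"] that by (simp add: vector_derivative_works)
    then have "((\<gamma> \<circ> (\<lambda>t. 1 - t)) has_vector_derivative
        (- 1) *\<^sub>R vector_derivative \<gamma> (at (1 - t))) (at t)"
      by (intro vector_diff_chain_at) (auto intro!: derivative_eq_intros)
    then show ?thesis
      by (simp add: metric_speed_def reversepath_def o_def vector_derivative_at)
  qed
  moreover have "finite ((\<lambda>t. 1 - t) ` T)" using T(1) by simp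
  \<comment> \<open>The argument is written \<open>1 + (-1) * t\<close> to fit the affine change of
    variables.\<close>
  ultimately have "AE t in lborel. ennreal (metric_speed (reversepath \<gamma>) t) * indicator {0..1} t
      = f (1 + (-1) * t)"
    using AE_not_in_finite[of "(\<lambda>t. 1 - t) ` T"]
    by (auto elim!: eventually_mono simp: f_def indicator_def image_iff)
       (metis diff_add_cancel add_diff_cancel_left' add.commute)+
  then have "plane_length (reversepath \<gamma>) = (\<integral>\<^sup>+t. f (1 + (-1) * t) \<partial>lborel)"
    unfolding path_length_plane by (rule nn_integral_cong_AE)
  also have "\<dots> = (\<integral>\<^sup>+t. f t \<partial>lborel)"
    using metric_speed_measurable[OF assms] nn_integral_real_affine[of f "-1" 1]
    by (simp add: f_def)
  finally show ?thesis by (simp add: path_length_plane f_def)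
qed

text \<open>Each half of the joined path is run at double speed over half the parameter interval;
  the change of variables cancels the factor 2.\<close>

lemma plane_length_joinpaths:
  assumes "valid_path \<gamma>" "valid_path \<eta>"
  shows "plane_length (\<gamma> +++ \<eta>) = plane_length \<gamma> + plane_length \<eta>"
proof -
  obtain T where T: "finite T" "\<And>t. t \<in> {0..1} - T \<Longrightarrow> \<gamma> differentiable at t"
    using assms(1) by (auto simp: valid_path_def piecewise_C1_differentiable_on_def C1_differentiable_on_eq)
  obtain U where U: "finite U" "\<And>t. t \<in> {0..1} - U \<Longrightarrow> \<eta> differentiable at t"
    using assms(2) by (auto simp: valid_path_def piecewise_C1_differentiable_on_def C1_differentiable_on_eq)
  define f where "f = (\<lambda>t. ennreal (metric_speed \<gamma> t) * indicator {0..1} t)"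
  define g where "g = (\<lambda>t. ennreal (metric_speed \<eta> t) * indicator {0..1} t)"
  have [measurable]: "f \<in> borel_measurable borel" "g \<in> borel_measurable borel"
    using metric_speed_measurable assms by (simp_all add: f_def g_def)
  have left: "metric_speed (\<gamma> +++ \<eta>) t = 2 * metric_speed \<gamma> (2 * t)"
    if "t \<in> {0..<1/2}" "2 * t \<notin> T" for t
  proof -
    have "(\<gamma> has_vector_derivative vector_derivative \<gamma> (at (2 * t))) (at (2 * t))"
      using T(2)[of "2 * t"] that by (simp add: vector_derivative_works)
    then have "((\<gamma> \<circ> (\<lambda>t. 2 * t)) has_vector_derivative 2 *\<^sub>R vector_derivative \<gamma> (at (2 * t))) (at t)"
      by (intro vector_diff_chain_at) (auto intro!: derivative_eq_intros)
    then have "(\<gamma> +++ \<eta> has_vector_derivative 2 *\<^sub>R vector_derivative \<gamma> (at (2 * t))) (at t)"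
      by (rule has_vector_derivative_transform_within_open[where S = "{..<1/2}"])
         (use that in \<open>auto simp: joinpaths_def\<close>)
    then have "vector_derivative (\<gamma> +++ \<eta>) (at t) = 2 *\<^sub>R vector_derivative \<gamma> (at (2 * t))"
      by (rule vector_derivative_at)
    then show ?thesis
      using that by (simp add: metric_speed_def joinpaths_def)
  qed
  have right: "metric_speed (\<gamma> +++ \<eta>) t = 2 * metric_speed \<eta> (2 * t - 1)"
    if "t \<in> {1/2<..1}" "2 * t - 1 \<notin> U" for t
  proof -
    have "(\<eta> has_vector_derivative vector_derivative \<eta> (at (2 * t - 1))) (at (2 * t - 1))"
      using U(2)[of "2 * t - 1"] that by (simp add: vector_derivative_works)
    then have "((\<eta> \<circ> (\<lambda>t. 2 * t - 1)) has_vector_derivative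
        2 *\<^sub>R vector_derivative \<eta> (at (2 * t - 1))) (at t)"
      by (intro vector_diff_chain_at) (auto intro!: derivative_eq_intros)
    then have "(\<gamma> +++ \<eta> has_vector_derivative 2 *\<^sub>R vector_derivative \<eta> (at (2 * t - 1))) (at t)"
      by (rule has_vector_derivative_transform_within_open[where S = "{1/2<..}"])
         (use that in \<open>auto simp: joinpaths_def\<close>)
    then have "vector_derivative (\<gamma> +++ \<eta>) (at t) = 2 *\<^sub>R vector_derivative \<eta> (at (2 * t - 1))"
      by (rule vector_derivative_at)
    then show ?thesis
      using that by (simp add: metric_speed_def joinpaths_def)
  qed
  \<comment> \<open>Away from the junction and the rescaled exceptional parameters, at most one of
    the two terms is nonzero.\<close>
  have eq: "ennreal (metric_speed (\<gamma> +++ \<eta>) t) * indicator {0..1} t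
      = 2 * f (0 + 2 * t) + 2 * g (-1 + 2 * t)"
    if "t \<notin> insert (1/2) ((\<lambda>t. t / 2) ` T \<union> (\<lambda>t. (1 + t) / 2) ` U)" for t
  proof -
    have "2 * t \<notin> T" "2 * t - 1 \<notin> U" "t \<noteq> 1/2"
      using that image_eqI[of t "\<lambda>t. t / 2" "2 * t" T] image_eqI[of t "\<lambda>t. (1 + t) / 2" "2 * t - 1" U]
      by auto
    moreover consider "t < 0" | "t \<in> {0..<1/2}" | "t \<in> {1/2<..1}" | "t > 1"
      using \<open>t \<noteq> 1/2\<close> by fastforce
    ultimately show ?thesis
      using left[of t] right[of t]
      by cases (auto simp: f_def g_def ennreal_mult indicator_def)
  qed
  have "plane_length (\<gamma> +++ \<eta>) = (\<integral>\<^sup>+t. 2 * f (0 + 2 * t) + 2 * g (-1 + 2 * t) \<partial>lborel)"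
    unfolding path_length_plane
  proof (rule nn_integral_cong_AE)
    have "finite (insert (1/2) ((\<lambda>t. t / 2) ` T \<union> (\<lambda>t. (1 + t) / 2) ` U))"
      using T(1) U(1) by simp
    from AE_not_in_finite[OF this]
    show "AE t in lborel. ennreal (metric_speed (\<gamma> +++ \<eta>) t) * indicator {0..1} t
      = 2 * f (0 + 2 * t) + 2 * g (-1 + 2 * t)"
      by eventually_elim (rule eq)
  qed
  also have "\<dots> = 2 * (\<integral>\<^sup>+t. f (0 + 2 * t) \<partial>lborel) + 2 * (\<integral>\<^sup>+t. g (-1 + 2 * t) \<partial>lborel)"
    by (subst nn_integral_add) (simp_all add: nn_integral_cmult)
  also have "\<dots> = (\<integral>\<^sup>+t. f t \<partial>lborel) + (\<integral>\<^sup>+t. g t \<partial>lborel)"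
    using nn_integral_real_affine[of f 2 0] nn_integral_real_affine[of g 2 "-1"] by simp
  finally show ?thesis by (simp add: path_length_plane f_def g_def)
qed

text \<open>All upper bounds on lengths come from here. The speed is continuous, so the length is an
  ordinary integral, and a majorant \<open>h\<close> with known integral bounds it.\<close>

lemma plane_length_C1_le:
  assumes "\<And>t. (\<gamma> has_vector_derivative \<gamma>' t) (at t)" "continuous_on {0..1} \<gamma>'"
    and "\<And>t. t \<in> {0..1} \<Longrightarrow> \<rho> (\<gamma> t) * norm (\<gamma>' t) \<le> h t"
    and "(h has_integral l) {0..1}"
  shows "valid_path \<gamma>" "plane_length \<gamma> \<le> ennreal l"
proof -
  show v: "valid_path \<gamma>"
    unfolding valid_path_def piecewise_C1_differentiable_on_def C1_differentiable_on_def
    using assms(1,2) continuous_on_vector_derivative[of "{0..1}" \<gamma> \<gamma>']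
    by (auto intro!: exI[of _ "{}"] exI[of _ \<gamma>'] intro: has_vector_derivative_at_within)
  have vd: "vector_derivative \<gamma> (at t) = \<gamma>' t" for t
    using assms(1) by (rule vector_derivative_at)
  have "continuous_on {0..1} (metric_speed \<gamma>)"
    unfolding metric_speed_def vd using assms(2) v
    by (intro continuous_intros continuous_on_compose2[OF continuous])
       (auto simp: valid_path_def piecewise_C1_differentiable_on_def)
  then have i: "metric_speed \<gamma> integrable_on {0..1}"
    by (rule integrable_continuous_interval)
  have "plane_length \<gamma> = ennreal (integral {0..1} (metric_speed \<gamma>))"
    unfolding path_length_plane
    using nn_integral_has_integral_lebesgue[OF metric_speed_nonneg integrable_integral[OF i]]
    by (simp add: nn_integral_set_ennreal mult.commute)
  also have "integral {0..1} (metric_speed \<gamma>) \<le> l"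
    using i assms(3,4) by (intro has_integral_le[OF integrable_integral[OF i] assms(4)])
      (auto simp: metric_speed_def vd)
  finally show "plane_length \<gamma> \<le> ennreal l" by (simp add: ennreal_leI)
qed


text \<open>The source of all lower bounds on distances: when the gradient of \<open>\<Phi>\<close>
  is at most \<open>\<rho>\<close>, the fundamental theorem of calculus along a path bounds the
  variation of \<open>\<Phi>\<close> by the length.\<close>

lemma lipschitz_le_plane_length:
  assumes \<Phi>: "\<And>z. (\<Phi> has_derivative \<Phi>' z) (at z)" "\<And>z v. \<bar>\<Phi>' z v\<bar> \<le> \<rho> z * norm v"
    and "valid_path \<gamma>"
  shows "ennreal \<bar>\<Phi> (pathfinish \<gamma>) - \<Phi> (pathstart \<gamma>)\<bar> \<le> plane_length \<gamma>"
proof (cases "plane_length \<gamma> = top")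
  case False
  obtain T where T: "finite T" "\<And>t. t \<in> {0..1} - T \<Longrightarrow> \<gamma> differentiable at t"
    and c: "continuous_on {0..1} \<gamma>"
    using assms(3) by (auto simp: valid_path_def piecewise_C1_differentiable_on_def C1_differentiable_on_eq)
  define g where "g t = \<Phi>' (\<gamma> t) (vector_derivative \<gamma> (at t))" for t
  define h where "h t = indicator {0..1} t *\<^sub>R g t" for t
  define I where "I = \<Phi> (pathfinish \<gamma>) - \<Phi> (pathstart \<gamma>)"
  \<comment> \<open>The gauge integral admits a fundamental theorem with finitely many exceptional
    parameters.\<close>
  have I: "(g has_integral I) {0..1}"
    unfolding I_def pathfinish_def pathstart_def
  proof (rule fundamental_theorem_of_calculus_interior_strong[OF T(1)])
    fix t :: real assume "t \<in> {0<..<1} - T"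
    then have "(\<gamma> has_derivative (\<lambda>s. s *\<^sub>R vector_derivative \<gamma> (at t))) (at t)"
      using T(2)[of t] by (simp add: vector_derivative_works has_vector_derivative_def)
    from diff_chain_at[OF this \<Phi>(1)]
    have "((\<lambda>t. \<Phi> (\<gamma> t)) has_derivative (\<lambda>s. \<Phi>' (\<gamma> t) (s *\<^sub>R vector_derivative \<gamma> (at t)))) (at t)"
      by (simp add: o_def)
    moreover have "linear (\<Phi>' (\<gamma> t))"
      using \<Phi>(1) has_derivative_linear by blast
    ultimately show "((\<lambda>t. \<Phi> (\<gamma> t)) has_vector_derivative g t) (at t)"
      by (simp add: has_vector_derivative_def g_def linear_cmul)
  next
    have "continuous_on UNIV \<Phi>"
      by (rule has_derivative_continuous_on[OF \<Phi>(1)])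
    from continuous_on_compose2[OF this c]
    show "continuous_on {0..1} (\<lambda>t. \<Phi> (\<gamma> t))" by simp
  qed simp
  have hm: "h \<in> borel_measurable lebesgue"
    using has_integral_implies_lebesgue_measurable[OF I] by (simp add: h_def[abs_def])
  have "ennreal (norm (h t)) \<le> ennreal (metric_speed \<gamma> t) * indicator {0..1} t" for t
    using \<Phi>(2)[of "\<gamma> t" "vector_derivative \<gamma> (at t)"]
    by (auto simp: h_def g_def metric_speed_def indicator_def intro!: ennreal_leI)
  then have le: "(\<integral>\<^sup>+t. norm (h t) \<partial>lebesgue) \<le> plane_length \<gamma>"
    unfolding path_length_plane nn_integral_completion by (rule nn_integral_mono)
  \<comment> \<open>Domination by the finite length turns the gauge integral into a Lebesgue
    integral, so that the absolute value can be taken inside.\<close>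
  then have "integrable lebesgue h"
    using hm False by (auto intro!: integrableI_bounded simp: top.not_eq_extremum less_le_trans order_le_less_trans)
  moreover have "h = (\<lambda>t. if t \<in> {0..1} then g t else 0)"
    by (auto simp: h_def indicator_def)
  then have "(h has_integral I) UNIV"
    using I by (simp only: has_integral_restrict_UNIV)
  ultimately have "I = integral\<^sup>L lebesgue h"
    using has_integral_integral_lebesgue has_integral_unique by blast
  then have "ennreal \<bar>I\<bar> \<le> (\<integral>\<^sup>+t. norm (h t) \<partial>lebesgue)"
    using integral_norm_bound_ennreal[OF \<open>integrable lebesgue h\<close>] by simp
  with le show ?thesis by (simp add: I_def)
qed simp

section \<open>The length distance\<close>

abbreviation "plane_dist \<equiv> length_dist (conformal_plane \<rho>)"

lemma plane_dist_eq:
  "plane_dist p q = enn2real (INF \<gamma> \<in> {\<gamma>. valid_path \<gamma> \<and> pathstart \<gamma> = p \<and> pathfinish \<gamma> = q}. plane_length \<gamma>)"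
  by (simp add: length_dist_def piecewise_C1_path_plane)

lemma plane_dist_le:
  assumes "valid_path \<gamma>" "pathstart \<gamma> = p" "pathfinish \<gamma> = q" "plane_length \<gamma> \<le> ennreal l" "0 \<le> l"
  shows "plane_dist p q \<le> l"
proof -
  have "(INF \<gamma> \<in> {\<gamma>. valid_path \<gamma> \<and> pathstart \<gamma> = p \<and> pathfinish \<gamma> = q}. plane_length \<gamma>) \<le> ennreal l"
    using assms by (intro INF_lower2[of \<gamma>]) auto
  then show ?thesis
    using assms(5) by (auto simp: plane_dist_eq intro: enn2real_leI)
qed

lemma bounded_on_compact:
  assumes "compact S"
  obtains K where "K > 0" "\<And>z. z \<in> S \<Longrightarrow> \<rho> z \<le> K"
proof -
  have "compact (\<rho> ` S)"
    using assms continuous continuous_on_subset by (blast intro: compact_continuous_image)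
  then obtain K where "\<And>z. z \<in> S \<Longrightarrow> norm (\<rho> z) \<le> K"
    using compact_imp_bounded bounded_iff by (metis imageI)
  then have "\<rho> z \<le> max K 1" if "z \<in> S" for z
    using that by fastforce
  then show thesis using that[of "max K 1"] by auto
qed

lemma plane_length_linepath:
  assumes "\<And>z. z \<in> closed_segment p q \<Longrightarrow> \<rho> z \<le> K"
  shows "plane_length (linepath p q) \<le> ennreal (K * dist p q)"
proof (rule plane_length_C1_le(2))
  show "(linepath p q has_vector_derivative q - p) (at t)" for t
    unfolding linepath_def by (auto intro!: derivative_eq_intros)
  show "\<rho> (linepath p q t) * norm (q - p) \<le> K * dist p q" if "t \<in> {0..1}" for t
    using assms[of "linepath p q t"] that
    by (simp add: dist_norm norm_minus_commute mult_right_mono linepath_in_path)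
  show "((\<lambda>t::real. K * dist p q) has_integral K * dist p q) {0..1}"
    using has_integral_const_real[of "K * dist p q" 0 1] by simp
qed simp

lemma plane_dist_le_dist:
  assumes "\<And>z. z \<in> closed_segment p q \<Longrightarrow> \<rho> z \<le> K"
  shows "plane_dist p q \<le> K * dist p q"
proof -
  have "0 < K"
    using positive[of p] assms[of p] by simp
  then show ?thesis
    using plane_length_linepath[OF assms] by (intro plane_dist_le[of "linepath p q"]) auto
qed

text \<open>As \<open>enn2real\<close> sends infinity to 0, the infimum must be known to be finite
  before it can be approached. The straight segment shows this, \<open>\<rho>\<close> being bounded
  on it.\<close>

lemma plane_dist_approx:
  assumes "e > 0"
  obtains \<gamma> where "valid_path \<gamma>" "pathstart \<gamma> = p" "pathfinish \<gamma> = q"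
    "plane_length \<gamma> \<le> ennreal (plane_dist p q + e)"
proof -
  define X where "X = {\<gamma>. valid_path \<gamma> \<and> pathstart \<gamma> = p \<and> pathfinish \<gamma> = q}"
  define m where "m = (INF \<gamma>\<in>X. plane_length \<gamma>)"
  obtain K where "\<And>z. z \<in> closed_segment p q \<Longrightarrow> \<rho> z \<le> K"
    using bounded_on_compact[of "closed_segment p q"] by auto
  then have "plane_length (linepath p q) \<le> ennreal (K * dist p q)"
    by (rule plane_length_linepath)
  moreover have "m \<le> plane_length (linepath p q)"
    unfolding m_def by (rule INF_lower) (simp add: X_def)
  ultimately have "m < top"
    by (meson ennreal_less_top order_le_less_trans)
  then have m: "m = ennreal (plane_dist p q)"
    by (simp add: m_def X_def plane_dist_eq)
  have "m < ennreal (plane_dist p q + e)"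
    using assms unfolding m by (intro ennreal_lessI) (auto simp: plane_dist_eq add_nonneg_pos)
  then obtain \<gamma> where "\<gamma> \<in> X" "plane_length \<gamma> < ennreal (plane_dist p q + e)"
    unfolding m_def INF_less_iff by blast
  then show thesis
    by (intro that[of \<gamma>]) (auto simp: X_def)
qed

lemma plane_dist_nonneg: "0 \<le> plane_dist p q"
  by (simp add: plane_dist_eq)

lemma plane_dist_self: "plane_dist p p = 0"
  using plane_dist_le_dist[of p p "\<rho> p"] plane_dist_nonneg[of p p] by simp

lemma plane_dist_commute: "plane_dist p q = plane_dist q p"
proof -
  have "plane_dist p q \<le> plane_dist q p" for p q
  proof (rule field_le_epsilon)
    fix e :: real assume "e > 0"
    then obtain \<gamma> where "valid_path \<gamma>" "pathstart \<gamma> = q" "pathfinish \<gamma> = p"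
      "plane_length \<gamma> \<le> ennreal (plane_dist q p + e)"
      using plane_dist_approx by blast
    then show "plane_dist p q \<le> plane_dist q p + e"
      using \<open>e > 0\<close> plane_dist_nonneg[of q p]
      by (intro plane_dist_le[of "reversepath \<gamma>"]) (auto simp: plane_length_reversepath)
  qed
  then show ?thesis by (meson order_antisym)
qed

lemma plane_dist_triangle: "plane_dist p r \<le> plane_dist p q + plane_dist q r"
proof (rule field_le_epsilon)
  fix e :: real assume e: "e > 0"
  obtain \<gamma> where \<gamma>: "valid_path \<gamma>" "pathstart \<gamma> = p" "pathfinish \<gamma> = q"
    "plane_length \<gamma> \<le> ennreal (plane_dist p q + e / 2)"
    using plane_dist_approx[of "e / 2"] e by auto
  obtain \<eta> where \<eta>: "valid_path \<eta>" "pathstart \<eta> = q" "pathfinish \<eta> = r"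
    "plane_length \<eta> \<le> ennreal (plane_dist q r + e / 2)"
    using plane_dist_approx[of "e / 2"] e by auto
  have "plane_length (\<gamma> +++ \<eta>) \<le> ennreal (plane_dist p q + e / 2) + ennreal (plane_dist q r + e / 2)"
    using \<gamma> \<eta> by (simp add: plane_length_joinpaths add_mono)
  also have "\<dots> = ennreal (plane_dist p q + plane_dist q r + e)"
    using e plane_dist_nonneg by (subst ennreal_plus[symmetric]) (auto simp: add_nonneg_nonneg)
  finally show "plane_dist p r \<le> plane_dist p q + plane_dist q r + e"
    using \<gamma> \<eta> e plane_dist_nonneg
    by (intro plane_dist_le[of "\<gamma> +++ \<eta>"]) (auto simp: add_nonneg_nonneg)
qed

lemma lipschitz_le_plane_dist:
  assumes "\<And>z. (\<Phi> has_derivative \<Phi>' z) (at z)" "\<And>z v. \<bar>\<Phi>' z v\<bar> \<le> \<rho> z * norm v"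
  shows "\<bar>\<Phi> q - \<Phi> p\<bar> \<le> plane_dist p q"
proof (rule field_le_epsilon)
  fix e :: real assume e: "e > 0"
  obtain \<gamma> where \<gamma>: "valid_path \<gamma>" "pathstart \<gamma> = p" "pathfinish \<gamma> = q"
    "plane_length \<gamma> \<le> ennreal (plane_dist p q + e)"
    using plane_dist_approx[OF e] by auto
  then have "ennreal \<bar>\<Phi> q - \<Phi> p\<bar> \<le> ennreal (plane_dist p q + e)"
    using lipschitz_le_plane_length[OF assms \<gamma>(1)] by simp
  then show "\<bar>\<Phi> q - \<Phi> p\<bar> \<le> plane_dist p q + e"
    using e plane_dist_nonneg[of p q] by (subst (asm) ennreal_le_iff) auto
qed

text \<open>Near \<open>q\<close> the density is at most some \<open>K\<close>, so by the triangle
  inequality the distance from \<open>p\<close> changes by at most \<open>K\<close> times the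
  Euclidean distance.\<close>

lemma continuous_plane_dist: "continuous_on UNIV (plane_dist p)"
proof -
  have "isCont (plane_dist p) q" for q
  proof -
    obtain K where K: "\<And>z. z \<in> cball q 1 \<Longrightarrow> \<rho> z \<le> K"
      using bounded_on_compact[of "cball q 1"] by auto
    have "\<bar>plane_dist p z - plane_dist p q\<bar> \<le> K * dist z q" if "dist z q < 1" for z
    proof -
      have "closed_segment z q \<subseteq> cball q 1"
        using that by (intro closed_segment_subset) (auto simp: dist_commute)
      then have "plane_dist z q \<le> K * dist z q"
        using K by (intro plane_dist_le_dist) auto
      then show ?thesis
        using plane_dist_triangle[of p q z] plane_dist_triangle[of p z q]
          plane_dist_commute[of q z] by linarith
    qed
    then have "\<forall>\<^sub>F z in at q. norm (plane_dist p z - plane_dist p q) \<le> K * dist z q"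
      by (auto simp: eventually_at intro!: exI[of _ 1])
    moreover have "((\<lambda>z. K * dist z q) \<longlongrightarrow> 0) (at q)"
      by (auto intro!: tendsto_eq_intros)
    ultimately have "((\<lambda>z. plane_dist p z - plane_dist p q) \<longlongrightarrow> 0) (at q)"
      by (rule Lim_null_comparison)
    then show ?thesis
      by (simp add: isCont_def LIM_zero_iff)
  qed
  then show ?thesis by (simp add: continuous_on_eq_continuous_at)
qed

text \<open>\<open>A\<close> and \<open>B\<close> are global 1-Lipschitz coordinates, and
  \<open>G\<close> recovers a point from them continuously. Hence they separate points, and along a
  Cauchy sequence they converge to real limits, which \<open>G\<close> maps to the limit
  point.\<close>

lemma complete_surface_plane:
  assumes lip: "\<And>p q. \<bar>A q - A p\<bar> \<le> plane_dist p q" "\<And>p q. \<bar>B q - B p\<bar> \<le> plane_dist p q"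
    and G: "continuous_on UNIV G" "\<And>z. G (A z, B z) = z"
  shows "complete_surface (conformal_plane \<rho>)" "Metric_space UNIV plane_dist"
proof -
  show M: "Metric_space UNIV plane_dist"
  proof
    show "plane_dist p q = 0 \<longleftrightarrow> p = q" for p q
    proof
      assume "plane_dist p q = 0"
      then have "A p = A q" "B p = B q"
        using lip[of q p] by auto
      then show "p = q" using G(2) by metis
    qed (simp add: plane_dist_self)
  qed (simp_all add: plane_dist_nonneg plane_dist_triangle plane_dist_commute)
  interpret M: Metric_space UNIV plane_dist by (rule M)
  have "\<exists>z. limitin M.mtopology \<sigma> z sequentially" if "M.MCauchy \<sigma>" for \<sigma>
  proof -
    have *: "Cauchy (\<lambda>n. F (\<sigma> n))" if F: "\<And>p q. \<bar>F q - F p\<bar> \<le> plane_dist p q" for F :: "complex \<Rightarrow> real"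
      unfolding Cauchy_def
    proof (intro allI impI)
      fix e :: real assume "e > 0"
      then obtain N where "\<And>m n. N \<le> m \<Longrightarrow> N \<le> n \<Longrightarrow> plane_dist (\<sigma> m) (\<sigma> n) < e"
        using \<open>M.MCauchy \<sigma>\<close> unfolding M.MCauchy_def by blast
      then show "\<exists>M. \<forall>m\<ge>M. \<forall>n\<ge>M. dist (F (\<sigma> m)) (F (\<sigma> n)) < e"
        using F by (metis dist_real_def order_le_less_trans)
    qed
    obtain a b where "(\<lambda>n. A (\<sigma> n)) \<longlonglongrightarrow> a" "(\<lambda>n. B (\<sigma> n)) \<longlonglongrightarrow> b"
      using *[OF lip(1)] *[OF lip(2)] by (auto simp: Cauchy_convergent_iff convergent_def)
    then have ab: "(\<lambda>n. (A (\<sigma> n), B (\<sigma> n))) \<longlonglongrightarrow> (a, b)"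
      by (rule tendsto_Pair)
    have "isCont G (a, b)"
      using G(1) by (simp add: continuous_on_eq_continuous_at)
    from isCont_tendsto_compose[OF this ab] have "\<sigma> \<longlonglongrightarrow> G (a, b)"
      by (simp add: G(2))
    \<comment> \<open>Continuity of the distance turns Euclidean convergence into convergence in the
      length metric.\<close>
    moreover have "isCont (plane_dist (G (a, b))) (G (a, b))"
      using continuous_plane_dist by (simp add: continuous_on_eq_continuous_at)
    ultimately have "(\<lambda>n. plane_dist (G (a, b)) (\<sigma> n)) \<longlonglongrightarrow> 0"
      using isCont_tendsto_compose plane_dist_self by metis
    then have "limitin M.mtopology \<sigma> (G (a, b)) sequentially"
      by (simp add: M.limitin_metric_dist_null plane_dist_commute)
    then show ?thesis ..
  qed
  then show "complete_surface (conformal_plane \<rho>)"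
    by (simp add: complete_surface_def M M.mcomplete_def)
qed

text \<open>Compact sets have finite area because \<open>\<rho>\<close> is bounded on them.\<close>

lemma area_measure_plane: "area_measure (conformal_plane \<rho>) (Nonnegative_Lebesgue_Integration.density lborel (\<lambda>z. ennreal ((\<rho> z)\<^sup>2)))"
proof -
  have [measurable]: "\<rho> \<in> borel_measurable borel"
    using continuous by (rule borel_measurable_continuous_onI)
  have "emeasure (Nonnegative_Lebesgue_Integration.density lborel (\<lambda>z. ennreal ((\<rho> z)\<^sup>2))) C < \<infinity>" if C: "compact C" for C
  proof -
    obtain K where K: "K > 0" "\<And>z. z \<in> C \<Longrightarrow> \<rho> z \<le> K"
      using bounded_on_compact[OF C] by auto
    have [measurable]: "C \<in> sets borel" using C by (simp add: borel_compact)
    have "(\<integral>\<^sup>+z\<in>C. ennreal ((\<rho> z)\<^sup>2) \<partial>lborel) \<le> (\<integral>\<^sup>+z. ennreal (K\<^sup>2) * indicator C z \<partial>lborel)"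
      using K(2) order.strict_implies_order[OF positive]
      by (intro nn_integral_mono) (auto simp: indicator_def intro!: ennreal_leI power_mono)
    also have "\<dots> = ennreal (K\<^sup>2) * emeasure lborel C"
      by (simp add: nn_integral_cmult_indicator)
    also have "\<dots> < \<infinity>"
      using emeasure_compact_finite[OF C] by (simp add: ennreal_mult_less_top)
    finally show ?thesis by (simp add: emeasure_density)
  qed
  then show ?thesis
    by (auto simp: area_measure_def radon_measure_on_def emeasure_density sets_restrict_space)
qed

end

section \<open>Integration over the complex plane and Green's identity\<close>

lemma Complex_measurable [measurable]: "(\<lambda>(x, y). Complex x y) \<in> borel_measurable (lborel \<Otimes>\<^sub>M lborel)"
proof -
  have "continuous_on UNIV (\<lambda>p :: real \<times> real. Complex (fst p) (snd p))"
    unfolding complex_eq by (intro continuous_intros)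
  from borel_measurable_continuous_onI[OF this] show ?thesis
    by (simp add: case_prod_beta' lborel_prod)
qed

text \<open>Lebesgue measure is determined by its values on boxes. This carries the theorems of
  Tonelli and Fubini over to the complex plane.\<close>

lemma distr_lborel_Complex: "distr (lborel \<Otimes>\<^sub>M lborel) borel (\<lambda>(x, y). Complex x y) = lborel"
proof (rule lborel_eqI[symmetric])
  fix l u :: complex
  assume lu: "\<And>b. b \<in> Basis \<Longrightarrow> l \<bullet> b \<le> u \<bullet> b"
  from lu[of 1] lu[of \<i>] have le: "Re l \<le> Re u" "Im l \<le> Im u"
    by (simp_all add: Basis_complex_def inner_complex_def)
  have "emeasure (distr (lborel \<Otimes>\<^sub>M lborel) borel (\<lambda>(x, y). Complex x y)) (box l u)
      = emeasure (lborel \<Otimes>\<^sub>M lborel) ((\<lambda>(x, y). Complex x y) -` box l u)"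
    by (subst emeasure_distr) (auto simp: space_pair_measure)
  also have "(\<lambda>(x, y). Complex x y) -` box l u = {Re l<..<Re u} \<times> {Im l<..<Im u}"
    by (auto simp: in_box_complex_iff)
  also have "emeasure (lborel \<Otimes>\<^sub>M lborel) \<dots> = ennreal (Re u - Re l) * ennreal (Im u - Im l)"
    using le by (subst lborel.emeasure_pair_measure_Times) auto
  also have "\<dots> = ennreal (\<Prod>b\<in>Basis. (u - l) \<bullet> b)"
    using le by (simp add: Basis_complex_def inner_complex_def ennreal_mult)
  finally show "emeasure (distr (lborel \<Otimes>\<^sub>M lborel) borel (\<lambda>(x, y). Complex x y)) (box l u)
      = ennreal (\<Prod>b\<in>Basis. (u - l) \<bullet> b)" .
qed simp

lemma nn_integral_lborel_complex:
  fixes f :: "complex \<Rightarrow> ennreal"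
  assumes [measurable]: "f \<in> borel_measurable borel"
  shows "(\<integral>\<^sup>+z. f z \<partial>lborel) = (\<integral>\<^sup>+y. \<integral>\<^sup>+x. f (Complex x y) \<partial>lborel \<partial>lborel)"
  by (subst distr_lborel_Complex[symmetric], subst nn_integral_distr)
     (auto simp: lborel_pair.nn_integral_snd[symmetric] case_prod_beta')

text \<open>Both orders are recorded, since the two second derivatives of a test function are
  integrated in different orders.\<close>

lemma
  fixes f :: "complex \<Rightarrow> real"
  assumes "integrable lborel f"
  shows integral_lborel_complex_xy: "(LINT z|lborel. f z) = (LINT y|lborel. (LINT x|lborel. f (Complex x y)))"
    and integral_lborel_complex_yx: "(LINT z|lborel. f z) = (LINT x|lborel. (LINT y|lborel. f (Complex x y)))"
proof -
  have [measurable]: "f \<in> borel_measurable borel"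
    using assms by auto
  have i: "integrable (lborel \<Otimes>\<^sub>M lborel) (\<lambda>(x, y). f (Complex x y))"
    using assms unfolding distr_lborel_Complex[symmetric]
    by (subst (asm) integrable_distr_eq) (auto simp: case_prod_beta')
  have "(LINT z|lborel. f z) = (LINT p|(lborel \<Otimes>\<^sub>M lborel). (\<lambda>(x, y). f (Complex x y)) p)"
    by (subst distr_lborel_Complex[symmetric], subst integral_distr) (auto simp: case_prod_beta')
  then show "(LINT z|lborel. f z) = (LINT y|lborel. (LINT x|lborel. f (Complex x y)))"
    "(LINT z|lborel. f z) = (LINT x|lborel. (LINT y|lborel. f (Complex x y)))"
    using lborel_pair.integral_fst'[OF i] lborel_pair.integral_snd[OF i] by auto
qed

lemma integrable_continuous_compact_support:
  fixes f :: "'a::euclidean_space \<Rightarrow> real"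
  assumes "continuous_on UNIV f" "compact K" "\<And>x. x \<notin> K \<Longrightarrow> f x = 0"
  shows "integrable lborel f"
proof -
  have "integrable lborel (\<lambda>x. indicator K x *\<^sub>R f x)"
    using assms(1,2) continuous_on_subset by (intro borel_integrable_compact) auto
  also have "(\<lambda>x. indicator K x *\<^sub>R f x) = f"
    using assms(3) by (auto simp: indicator_def fun_eq_iff)
  finally show ?thesis .
qed

text \<open>Links the gauge integrals delivered by the fundamental theorem of calculus with the
  Lebesgue integrals in Fubini's theorem.\<close>

lemma integral_eq_if_has_integral_Icc:
  fixes f :: "real \<Rightarrow> real"
  assumes "continuous_on UNIV f" "\<And>x. M \<le> \<bar>x\<bar> \<Longrightarrow> f x = 0" "(f has_integral I) {-M..M}"
  shows "(LINT x|lborel. f x) = I"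
proof -
  have "integrable lborel f"
    using assms(1,2) by (intro integrable_continuous_compact_support[where K = "{-M..M}"]) auto
  then have "(f has_integral (LINT x|lborel. f x)) UNIV"
    by (rule has_integral_integral_lborel)
  moreover have "(f has_integral I) UNIV"
    by (rule has_integral_on_superset[OF assms(3)]) (use assms(2) in auto)
  ultimately show ?thesis by (rule has_integral_unique)
qed

section \<open>One-dimensional Green identities\<close>

lemma half_line_green:
  fixes a a' a'' \<phi> \<phi>' \<phi>'' :: "real \<Rightarrow> real"
  assumes "\<And>t. t \<ge> 0 \<Longrightarrow> (a has_real_derivative a' t) (at t)"
    and "\<And>t. t \<ge> 0 \<Longrightarrow> (a' has_real_derivative a'' t) (at t)"
    and "\<And>t. (\<phi> has_real_derivative \<phi>' t) (at t)" "\<And>t. (\<phi>' has_real_derivative \<phi>'' t) (at t)"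
    and "\<phi> M = 0" "\<phi>' M = 0" "M \<ge> 0"
  shows "((\<lambda>t. a t * \<phi>'' t - a'' t * \<phi> t) has_integral a' 0 * \<phi> 0 - a 0 * \<phi>' 0) {0..M}"
proof -
  have "((\<lambda>t. a t * \<phi>'' t - a'' t * \<phi> t) has_integral
      (a M * \<phi>' M - a' M * \<phi> M) - (a 0 * \<phi>' 0 - a' 0 * \<phi> 0)) {0..M}"
  proof (rule fundamental_theorem_of_calculus)
    fix t assume "t \<in> {0..M}"
    then have "((\<lambda>t. a t * \<phi>' t - a' t * \<phi> t) has_real_derivative a t * \<phi>'' t - a'' t * \<phi> t) (at t)"
      using assms(1-4) by (auto intro!: derivative_eq_intros simp: algebra_simps)
    then show "((\<lambda>t. a t * \<phi>' t - a' t * \<phi> t) has_vector_derivative a t * \<phi>'' t - a'' t * \<phi> t)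
        (at t within {0..M})"
      by (simp add: has_real_derivative_iff_has_vector_derivative has_vector_derivative_at_within)
  qed (use assms in simp)
  with assms show ?thesis by simp
qed

text \<open>The even extension of \<open>a\<close> has a corner at 0. When the two half lines are
  added, the terms with \<open>a 0\<close> cancel and those with \<open>a' 0\<close> double, which
  leaves the jump of the slope.\<close>

lemma even_green:
  fixes a a' a'' \<phi> \<phi>' \<phi>'' :: "real \<Rightarrow> real"
  assumes a: "\<And>t. t \<ge> 0 \<Longrightarrow> (a has_real_derivative a' t) (at t)"
      "\<And>t. t \<ge> 0 \<Longrightarrow> (a' has_real_derivative a'' t) (at t)"
    and \<phi>: "\<And>t. (\<phi> has_real_derivative \<phi>' t) (at t)" "\<And>t. (\<phi>' has_real_derivative \<phi>'' t) (at t)"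
    and M: "\<And>t. M \<le> \<bar>t\<bar> \<Longrightarrow> \<phi> t = 0" "\<And>t. M \<le> \<bar>t\<bar> \<Longrightarrow> \<phi>' t = 0" "M \<ge> 0"
  shows "((\<lambda>t. a \<bar>t\<bar> * \<phi>'' t - a'' \<bar>t\<bar> * \<phi> t) has_integral 2 * (a' 0 * \<phi> 0)) {-M..M}"
proof -
  let ?f = "\<lambda>t. a \<bar>t\<bar> * \<phi>'' t - a'' \<bar>t\<bar> * \<phi> t"
  have "((\<lambda>t. a t * \<phi>'' t - a'' t * \<phi> t) has_integral a' 0 * \<phi> 0 - a 0 * \<phi>' 0) {0..M}"
    using M by (intro half_line_green a \<phi>) auto
  then have r: "(?f has_integral a' 0 * \<phi> 0 - a 0 * \<phi>' 0) {0..M}"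
    by (rule has_integral_eq[rotated]) auto
  \<comment> \<open>The negative half line is reflected onto the positive one, which changes the
    sign of \<open>\<phi>'\<close>.\<close>
  have "((\<lambda>t. a t * \<phi>'' (- t) - a'' t * \<phi> (- t)) has_integral
      a' 0 * \<phi> (- 0) - a 0 * (- \<phi>' (- 0))) {0..M}"
  proof (rule half_line_green[where \<phi>' = "\<lambda>t. - \<phi>' (- t)"])
    show "((\<lambda>t. \<phi> (- t)) has_real_derivative - \<phi>' (- t)) (at t)" for t
      using \<phi>(1)[of "- t"] by (rule DERIV_mirror[THEN iffD1])
    show "((\<lambda>t. - \<phi>' (- t)) has_real_derivative \<phi>'' (- t)) (at t)" for t
      using DERIV_minus[OF DERIV_mirror[THEN iffD1, OF \<phi>(2)[of "- t"]]] by simp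
  qed (use M a in auto)
  then have "((\<lambda>t. a t * \<phi>'' (- t) - a'' t * \<phi> (- t)) has_integral
      a' 0 * \<phi> 0 + a 0 * \<phi>' 0) {0..M}"
    by simp
  then have "((\<lambda>t. ?f (- t)) has_integral a' 0 * \<phi> 0 + a 0 * \<phi>' 0) {0..M}"
    by (rule has_integral_eq[rotated]) auto
  then have "(?f has_integral a' 0 * \<phi> 0 + a 0 * \<phi>' 0) {-M..0}"
    using has_integral_reflect_real[of ?f "a' 0 * \<phi> 0 + a 0 * \<phi>' 0" 0 "-M"]
    by (simp only: minus_zero minus_minus)
  then have "(?f has_integral (a' 0 * \<phi> 0 + a 0 * \<phi>' 0) + (a' 0 * \<phi> 0 - a 0 * \<phi>' 0)) {-M..M}"
    using M(3) by (intro has_integral_combine[OF _ _ _ r]) auto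
  then show ?thesis by (simp add: mult.commute[of "\<phi> 0"])
qed

section \<open>Partial derivatives of test functions\<close>

lemma partial_x_has_derivative:
  assumes "f differentiable at (Complex x y)"
  shows "((\<lambda>t. f (Complex t y)) has_real_derivative partial_x f (Complex x y)) (at x)"
proof -
  have "(\<lambda>t :: real. f (Complex x y + of_real t)) differentiable at 0"
    by (rule differentiable_chain_at[unfolded o_def, where f = "\<lambda>t. Complex x y + of_real t"])
      (use assms in simp_all)
  then have "((\<lambda>t. f (Complex x y + of_real t)) has_real_derivative partial_x f (Complex x y)) (at 0)"
    by (simp add: partial_x_def DERIV_deriv_iff_real_differentiable)
  also have "(\<lambda>t. f (Complex x y + of_real t)) = (\<lambda>t. f (Complex (t + x) y))"
    by (intro ext arg_cong[where f = f]) (simp add: complex_eq_iff)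
  finally show ?thesis
    using DERIV_shift[of "\<lambda>t. f (Complex t y)" "partial_x f (Complex x y)" 0 x] by simp
qed

lemma partial_y_has_derivative:
  assumes "f differentiable at (Complex x y)"
  shows "((\<lambda>t. f (Complex x t)) has_real_derivative partial_y f (Complex x y)) (at y)"
proof -
  have "(\<lambda>t :: real. f (Complex x y + \<i> * of_real t)) differentiable at 0"
    by (rule differentiable_chain_at[unfolded o_def, where f = "\<lambda>t. Complex x y + \<i> * of_real t"])
      (use assms in simp_all)
  then have "((\<lambda>t. f (Complex x y + \<i> * of_real t)) has_real_derivative partial_y f (Complex x y)) (at 0)"
    by (simp add: partial_y_def DERIV_deriv_iff_real_differentiable)
  also have "(\<lambda>t. f (Complex x y + \<i> * of_real t)) = (\<lambda>t. f (Complex x (t + y)))"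
    by (intro ext arg_cong[where f = f]) (simp add: complex_eq_iff)
  finally show ?thesis
    using DERIV_shift[of "\<lambda>t. f (Complex x t)" "partial_y f (Complex x y)" 0 y] by simp
qed

text \<open>Derivatives depend only on values nearby, so the partial derivatives of a test function
  vanish off its support.\<close>

lemma
  assumes "open U" "z \<in> U" "\<And>w. w \<in> U \<Longrightarrow> f w = 0"
  shows partial_x_eq_0: "partial_x f z = 0" and partial_y_eq_0: "partial_y f z = 0"
proof -
  have *: "deriv (\<lambda>t::real. f (z + c * of_real t)) 0 = 0" for c
  proof -
    have "open ((\<lambda>t::real. z + c * of_real t) -` U)"
      using assms(1) by (intro open_vimage continuous_intros)
    then have "\<forall>\<^sub>F t::real in nhds 0. f (z + c * of_real t) = 0"
      using assms(2,3) unfolding eventually_nhds by (intro exI[of _ "(\<lambda>t::real. z + c * of_real t) -` U"]) auto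
    then have "deriv (\<lambda>t::real. f (z + c * of_real t)) 0 = deriv (\<lambda>t::real. 0) 0"
      by (intro deriv_cong_ev) auto
    then show ?thesis by simp
  qed
  show "partial_x f z = 0" "partial_y f z = 0"
    using *[of 1] *[of \<i>] by (simp_all add: partial_x_def partial_y_def)
qed

lemma test_functionE:
  assumes "test_function \<Omega> g"
  obtains M where "M \<ge> 0"
    "\<And>z. g differentiable at z" "\<And>z. partial_x g differentiable at z" "\<And>z. partial_y g differentiable at z"
    "continuous_on UNIV (partial_x (partial_x g))" "continuous_on UNIV (partial_y (partial_y g))"
    "\<And>z. M \<le> norm z \<Longrightarrow> g z = 0"
    "\<And>z. M \<le> norm z \<Longrightarrow> partial_x g z = 0" "\<And>z. M \<le> norm z \<Longrightarrow> partial_y g z = 0"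
    "\<And>z. M \<le> norm z \<Longrightarrow> partial_x (partial_x g) z = 0"
    "\<And>z. M \<le> norm z \<Longrightarrow> partial_y (partial_y g) z = 0"
proof -
  have ck: "C_k (Suc (Suc 0)) g"
    using assms by (simp only: test_function_def)
  obtain K where K: "compact K" "\<And>z. z \<notin> K \<Longrightarrow> g z = 0"
    using assms by (auto simp: test_function_def)
  \<comment> \<open>The strict bound on \<open>K\<close> places all of \<open>M \<le> norm z\<close>
    in the open complement of \<open>K\<close>, where the derivatives vanish too.\<close>
  obtain M where M: "M > 0" "\<And>z. z \<in> K \<Longrightarrow> norm z < M"
    using compact_imp_bounded[OF K(1)] bounded_pos_less by metis
  have op: "open (- K)"
    using K(1) by (simp add: compact_imp_closed open_Compl)
  have 1: "partial_x g z = 0" "partial_y g z = 0" if "z \<in> - K" for z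
    using partial_x_eq_0[OF op that] partial_y_eq_0[OF op that] K(2) by simp_all
  have 2: "partial_x (partial_x g) z = 0" "partial_y (partial_y g) z = 0" if "z \<in> - K" for z
    using partial_x_eq_0[OF op that] partial_y_eq_0[OF op that] 1 by simp_all
  have "z \<in> - K" if "M \<le> norm z" for z
    using M(2)[of z] that by auto
  then show thesis
    using ck M(1) K(2) 1 2 by (intro that[of M]) auto
qed

section \<open>The metric and its curvature\<close>

text \<open>Let \<open>w = \<bar>Re z\<bar> + i Im z\<close> be \<open>z\<close> folded into the
  right half plane. Then \<open>rad z\<close> is the modulus of \<open>1 + w\<close>, and
  \<open>rho z\<close> is that of the holomorphic function \<open>exp (2 w) / (1 + w)\<close>,
  whence the harmonicity of \<open>ln rho\<close> off the axis.\<close>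

definition rad :: "complex \<Rightarrow> real" where
  "rad z = sqrt ((1 + \<bar>Re z\<bar>)\<^sup>2 + (Im z)\<^sup>2)"

definition rho :: "complex \<Rightarrow> real" where
  "rho z = exp (2 * \<bar>Re z\<bar>) / rad z"

lemma rad_sq_pos: "0 < (1 + \<bar>x\<bar>)\<^sup>2 + (y :: real)\<^sup>2"
  by (intro add_pos_nonneg) auto

lemma rad_ge_1: "1 \<le> rad z"
proof -
  have "1 \<le> (1 + \<bar>Re z\<bar>)\<^sup>2"
    by (simp add: power2_eq_square algebra_simps)
  then have "1 \<le> (1 + \<bar>Re z\<bar>)\<^sup>2 + (Im z)\<^sup>2"
    by (metis add_increasing2 zero_le_power2)
  then show ?thesis by (simp add: rad_def)
qed

lemma rho_pos: "0 < rho z"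
  using rad_ge_1[of z] by (auto simp: rho_def intro!: divide_pos_pos)

lemma rad_continuous [continuous_intros]: "continuous_on S rad"
  unfolding rad_def by (intro continuous_intros)

lemma rho_continuous: "continuous_on S rho"
  unfolding rho_def
  by (intro continuous_intros ballI) (use rad_ge_1 in \<open>metis not_one_le_zero\<close>)

interpretation rho: plane_length_element rho
  by standard (rule rho_continuous, rule rho_pos)

abbreviation rho_plane :: "complex surface" where "rho_plane \<equiv> conformal_plane rho"

lemma ln_rho: "ln (rho z) = 2 * \<bar>Re z\<bar> - ln ((1 + \<bar>Re z\<bar>)\<^sup>2 + (Im z)\<^sup>2) / 2"
  using rad_ge_1[of z] rad_sq_pos[of "Re z" "Im z"]
  by (simp add: rho_def ln_div rad_def ln_sqrt)

lemma ln_rho_continuous: "continuous_on S (\<lambda>z. ln (rho z))"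
  by (intro continuous_intros rho_continuous ballI) (metis rho_pos less_irrefl)

text \<open>Twice the slope \<open>2 - 1 / (1 + y\<^sup>2)\<close> of \<open>ln rho\<close> in the
  direction of \<open>x\<close> on the right side of the axis; by evenness in \<open>x\<close> this
  is the jump of the normal derivative.\<close>

definition axis_curvature :: "real \<Rightarrow> real" where
  "axis_curvature y = 4 - 2 / (1 + y\<^sup>2)"

lemma axis_curvature_bounds: "2 \<le> axis_curvature y" "axis_curvature y \<le> 4"
  by (auto simp: axis_curvature_def divide_simps add_pos_nonneg)

lemma axis_curvature_measurable [measurable]: "axis_curvature \<in> borel_measurable borel"
  unfolding axis_curvature_def[abs_def] by measurable

lemma axis_measurable [measurable]: "Complex 0 \<in> borel_measurable borel"
proof -
  have "continuous_on UNIV (\<lambda>y. Complex 0 y)"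
    unfolding complex_eq by (intro continuous_intros)
  then show ?thesis by (rule borel_measurable_continuous_onI)
qed

text \<open>The second derivative of \<open>ln \<rho>\<close> in \<open>x\<close> and, as \<open>ln \<rho>\<close> is harmonic there, minus the one in \<open>y\<close>,
  off the imaginary axis.\<close>

definition ln_rho_xx :: "complex \<Rightarrow> real" where
  "ln_rho_xx z = ((1 + \<bar>Re z\<bar>)\<^sup>2 - (Im z)\<^sup>2) / ((1 + \<bar>Re z\<bar>)\<^sup>2 + (Im z)\<^sup>2)\<^sup>2"

lemma ln_rho_xx_continuous: "continuous_on S ln_rho_xx"
  unfolding ln_rho_xx_def
  by (intro continuous_intros ballI) (metis less_irrefl power_not_zero rad_sq_pos)

text \<open>\<open>even_green\<close> is applied to the formula for \<open>ln rho\<close> on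
  \<open>x \<ge> 0\<close> without absolute values; the corner at the axis yields
  \<open>axis_curvature\<close>.\<close>

lemma green_x:
  assumes "\<And>t. (\<phi> has_real_derivative \<phi>' t) (at t)" "\<And>t. (\<phi>' has_real_derivative \<phi>'' t) (at t)"
    and "\<And>t. M \<le> \<bar>t\<bar> \<Longrightarrow> \<phi> t = 0" "\<And>t. M \<le> \<bar>t\<bar> \<Longrightarrow> \<phi>' t = 0" "M \<ge> 0"
  shows "((\<lambda>x. ln (rho (Complex x y)) * \<phi>'' x - ln_rho_xx (Complex x y) * \<phi> x)
    has_integral axis_curvature y * \<phi> 0) {-M..M}"
proof -
  define q where "q x = (1 + x)\<^sup>2 + y\<^sup>2" for x :: real
  have q: "q x > 0" if "x \<ge> 0" for x
    using rad_sq_pos[of x y] that by (simp add: q_def)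
  have dq: "(q has_real_derivative 2 * (1 + x)) (at x)" for x
    unfolding q_def by (auto intro!: derivative_eq_intros)
  let ?a = "\<lambda>x. 2 * x - ln (q x) / 2"
  let ?a' = "\<lambda>x. 2 - (1 + x) / q x"
  let ?a'' = "\<lambda>x. ((1 + x)\<^sup>2 - y\<^sup>2) / (q x)\<^sup>2"
  have "((\<lambda>x. ?a \<bar>x\<bar> * \<phi>'' x - ?a'' \<bar>x\<bar> * \<phi> x) has_integral 2 * (?a' 0 * \<phi> 0)) {-M..M}"
  proof (rule even_green[where a = ?a and a' = ?a' and \<phi>' = \<phi>'])
    fix x :: real assume x: "x \<ge> 0"
    show "(?a has_real_derivative ?a' x) (at x)"
      using q[OF x] by (auto intro!: derivative_eq_intros dq simp: field_simps)
    \<comment> \<open>Expanding \<open>q\<close> brings the raw result of the quotient rule into the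
      form \<open>?a''\<close>.\<close>
    have "0 - (1 * q x - (1 + x) * (2 * (1 + x))) / (q x * q x) = ?a'' x"
      unfolding diff_0 minus_divide_left by (simp add: q_def power2_eq_square algebra_simps)
    moreover have "((\<lambda>x. 1 + x) has_real_derivative 1) (at x)"
      by (auto intro!: derivative_eq_intros)
    then have "(?a' has_real_derivative 0 - (1 * q x - (1 + x) * (2 * (1 + x))) / (q x * q x)) (at x)"
      using q[OF x] by (intro DERIV_diff DERIV_divide DERIV_const dq less_imp_neq[THEN not_sym])
    ultimately show "(?a' has_real_derivative ?a'' x) (at x)" by simp
  qed (use assms in auto)
  then show ?thesis
    by (simp add: ln_rho ln_rho_xx_def q_def axis_curvature_def algebra_simps)
qed

text \<open>In the direction of \<open>y\<close> the function \<open>ln rho\<close> is smooth, so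
  there is no jump, and the boundary terms vanish with \<open>\<phi>\<close>. Its second derivative
  is \<open>- ln_rho_xx\<close>, hence the plus sign.\<close>

lemma green_y:
  assumes "\<And>t. (\<phi> has_real_derivative \<phi>' t) (at t)" "\<And>t. (\<phi>' has_real_derivative \<phi>'' t) (at t)"
    and "\<And>t. M \<le> \<bar>t\<bar> \<Longrightarrow> \<phi> t = 0" "\<And>t. M \<le> \<bar>t\<bar> \<Longrightarrow> \<phi>' t = 0" "M \<ge> 0"
  shows "((\<lambda>y. ln (rho (Complex x y)) * \<phi>'' y + ln_rho_xx (Complex x y) * \<phi> y) has_integral 0) {-M..M}"
proof -
  define q where "q y = (1 + \<bar>x\<bar>)\<^sup>2 + y\<^sup>2" for y :: real
  have q: "q y > 0" for y
    using rad_sq_pos[of x y] by (simp add: q_def)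
  have dq: "(q has_real_derivative 2 * y) (at y)" for y
    unfolding q_def by (auto intro!: derivative_eq_intros)
  let ?a = "\<lambda>y. 2 * \<bar>x\<bar> - ln (q y) / 2"
  let ?a' = "\<lambda>y. - y / q y"
  let ?a'' = "\<lambda>y. - (((1 + \<bar>x\<bar>)\<^sup>2 - y\<^sup>2) / (q y)\<^sup>2)"
  let ?F = "\<lambda>y. ?a y * \<phi>' y - ?a' y * \<phi> y"
  have "((\<lambda>y. ?a y * \<phi>'' y - ?a'' y * \<phi> y) has_integral ?F M - ?F (- M)) {-M..M}"
  proof (rule fundamental_theorem_of_calculus)
    fix y assume "y \<in> {-M..M}"
    have 1: "(?a has_real_derivative ?a' y) (at y)"
      using q[of y] by (auto intro!: derivative_eq_intros dq)
    have "(- 1 * q y - - y * (2 * y)) / (q y * q y) = ?a'' y"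
      unfolding minus_divide_left by (simp add: q_def power2_eq_square algebra_simps)
    moreover have "(?a' has_real_derivative (- 1 * q y - - y * (2 * y)) / (q y * q y)) (at y)"
      using q[of y] by (intro DERIV_divide DERIV_minus DERIV_ident dq) simp
    ultimately have 2: "(?a' has_real_derivative ?a'' y) (at y)" by simp
    have "(?F has_real_derivative ?a y * \<phi>'' y - ?a'' y * \<phi> y) (at y)"
      by (rule derivative_eq_intros 1 2 assms refl)+ (simp add: algebra_simps)
    then show "(?F has_vector_derivative ?a y * \<phi>'' y - ?a'' y * \<phi> y) (at y within {-M..M})"
      by (simp add: has_real_derivative_iff_has_vector_derivative has_vector_derivative_at_within)
  qed (use assms in simp)
  then show ?thesis
    using assms(3)[of M] assms(3)[of "-M"] assms(4)[of M] assms(4)[of "-M"] \<open>M \<ge> 0\<close>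
    by (simp add: ln_rho ln_rho_xx_def q_def)
qed

lemma continuous_on_Complex:
  assumes "continuous_on UNIV f"
  shows "continuous_on S (\<lambda>x. f (Complex x y))" "continuous_on T (\<lambda>y. f (Complex x y))"
  unfolding complex_eq
  by (rule continuous_on_compose2[OF assms]; intro continuous_intros subset_UNIV)+

text \<open>Subtracting and adding \<open>ln_rho_xx z * g z\<close> splits the integrand into
  \<open>F\<close> and \<open>G\<close>, continuous with compact support. \<open>F\<close> is
  integrated first in \<open>x\<close> and leaves the jump on the axis; \<open>G\<close> is
  integrated first in \<open>y\<close> and leaves nothing.\<close>

lemma weak_laplacian_ln_rho:
  assumes "test_function \<Omega> g"
  shows "(LINT z|lborel. ln (rho z) * laplacian g z)
    = (LINT y|lborel. axis_curvature y * g (Complex 0 y))"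
proof -
  obtain M where M: "M \<ge> 0"
    and d: "\<And>z. g differentiable at z" "\<And>z. partial_x g differentiable at z" "\<And>z. partial_y g differentiable at z"
    and c: "continuous_on UNIV (partial_x (partial_x g))" "continuous_on UNIV (partial_y (partial_y g))"
    and z: "\<And>z. M \<le> norm z \<Longrightarrow> g z = 0"
    "\<And>z. M \<le> norm z \<Longrightarrow> partial_x g z = 0" "\<And>z. M \<le> norm z \<Longrightarrow> partial_y g z = 0"
    "\<And>z. M \<le> norm z \<Longrightarrow> partial_x (partial_x g) z = 0"
    "\<And>z. M \<le> norm z \<Longrightarrow> partial_y (partial_y g) z = 0"
    by (rule test_functionE[OF assms]) (rule that; assumption)
  have cg: "continuous_on UNIV g"
    using d(1) by (simp add: continuous_on_eq_continuous_at differentiable_imp_continuous_within)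
  have big: "M \<le> norm (Complex x y)" if "M \<le> \<bar>x\<bar> \<or> M \<le> \<bar>y\<bar>" for x y
    using that abs_Re_le_cmod[of "Complex x y"] abs_Im_le_cmod[of "Complex x y"] by auto
  define F where "F z = ln (rho z) * partial_x (partial_x g) z - ln_rho_xx z * g z" for z
  define G where "G z = ln (rho z) * partial_y (partial_y g) z + ln_rho_xx z * g z" for z
  have cFG: "continuous_on UNIV F" "continuous_on UNIV G"
    unfolding F_def G_def by (intro continuous_intros ln_rho_continuous ln_rho_xx_continuous c cg)+
  have zFG: "F z = 0" "G z = 0" if "M \<le> norm z" for z
    using z that by (simp_all add: F_def G_def)
  have iFG: "integrable lborel F" "integrable lborel G"
    by (rule integrable_continuous_compact_support[where K = "cball 0 M"]; use cFG zFG in auto)+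
  have "(LINT x|lborel. F (Complex x y)) = axis_curvature y * g (Complex 0 y)" for y
  proof (rule integral_eq_if_has_integral_Icc[where M = M])
    show "((\<lambda>x. F (Complex x y)) has_integral axis_curvature y * g (Complex 0 y)) {- M..M}"
      unfolding F_def
      by (rule green_x[where \<phi> = "\<lambda>t. g (Complex t y)" and \<phi>' = "\<lambda>t. partial_x g (Complex t y)"])
         (use M big z partial_x_has_derivative d in auto)
  qed (use continuous_on_Complex cFG zFG big in auto)
  moreover have "(LINT y|lborel. G (Complex x y)) = 0" for x
  proof (rule integral_eq_if_has_integral_Icc[where M = M])
    show "((\<lambda>y. G (Complex x y)) has_integral 0) {- M..M}"
      unfolding G_def
      by (rule green_y[where \<phi> = "\<lambda>t. g (Complex x t)" and \<phi>' = "\<lambda>t. partial_y g (Complex x t)"])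
         (use M big z partial_y_has_derivative d in auto)
  qed (use continuous_on_Complex cFG zFG big in auto)
  ultimately have "(LINT z|lborel. F z) + (LINT z|lborel. G z)
      = (LINT y|lborel. axis_curvature y * g (Complex 0 y))"
    using integral_lborel_complex_xy[OF iFG(1)] integral_lborel_complex_yx[OF iFG(2)] by simp
  moreover have "(LINT z|lborel. F z) + (LINT z|lborel. G z) = (LINT z|lborel. F z + G z)"
    using iFG by simp
  moreover have "F z + G z = ln (rho z) * laplacian g z" for z
    by (simp add: F_def G_def laplacian_def algebra_simps)
  ultimately show ?thesis by simp
qed

text \<open>Minus the curvature: a positive measure carried by the imaginary axis, to be used as the
  second component of the pair.\<close>

definition rho_curvature :: "complex measure" where
  "rho_curvature = distr (Nonnegative_Lebesgue_Integration.density lborel (\<lambda>y. ennreal (axis_curvature y))) borel (Complex 0)"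

lemma emeasure_rho_curvature:
  assumes "A \<in> sets borel"
  shows "emeasure rho_curvature A = (\<integral>\<^sup>+y. ennreal (axis_curvature y) * indicator A (Complex 0 y) \<partial>lborel)"
proof -
  have [measurable]: "A \<in> sets borel" by (rule assms)
  have "emeasure rho_curvature A = (\<integral>\<^sup>+y. ennreal (axis_curvature y) * indicator (Complex 0 -` A) y \<partial>lborel)"
    unfolding rho_curvature_def
    by (subst emeasure_distr) (auto simp: emeasure_density intro!: emeasure_density measurable_sets_borel[of _ borel])
  then show ?thesis by (simp add: indicator_def)
qed

text \<open>A compact set meets the axis in a bounded set, on which the density is at most 4; this
  gives local finiteness. The distributional identity is
  \<open>weak_laplacian_ln_rho\<close>.\<close>

lemma curvature_measure_rho_plane: "curvature_measure rho_plane (null_measure borel, rho_curvature)"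
  unfolding curvature_measure_def
proof (intro conjI ballI allI impI)
  show "radon_measure_on (points rho_plane) (fst (null_measure borel, rho_curvature))"
    by (simp add: radon_measure_on_def sets_restrict_space)
  have "emeasure rho_curvature C < \<infinity>" if C: "compact C" for C
  proof -
    obtain M where M: "\<And>z. z \<in> C \<Longrightarrow> norm z \<le> M"
      using compact_imp_bounded[OF C] bounded_iff by metis
    have CM: "y \<in> {-M..M}" if "Complex 0 y \<in> C" for y
      using M[OF that] abs_Im_le_cmod[of "Complex 0 y"] by auto
    have le: "ennreal (axis_curvature y) \<le> 4" for y
      using ennreal_leI[OF axis_curvature_bounds(2)[of y]] by simp
    have "emeasure rho_curvature C \<le> (\<integral>\<^sup>+y. 4 * indicator {-M..M} y \<partial>lborel)"
      unfolding emeasure_rho_curvature[OF borel_compact[OF C]]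
      using CM le by (intro nn_integral_mono) (auto simp: indicator_def)
    also have "\<dots> = 4 * emeasure lborel {-M..M}"
      by (rule nn_integral_cmult_indicator) simp
    also have "\<dots> < \<infinity>"
      by (simp add: ennreal_mult_less_top emeasure_lborel_Icc_eq)
    finally show ?thesis .
  qed
  then show "radon_measure_on (points rho_plane) (snd (null_measure borel, rho_curvature))"
    by (simp add: radon_measure_on_def sets_restrict_space rho_curvature_def)
next
  fix c g assume c: "c \<in> atlas rho_plane" and "test_function (snd c ` fst c) g"
  then have g: "test_function UNIV g" and c: "c = (UNIV, id)" by auto
  have "C_k (Suc 0) g"
    using g by (simp only: test_function_def)
  then have "continuous_on UNIV g"
    by (simp add: continuous_on_eq_continuous_at differentiable_imp_continuous_within)
  then have [measurable]: "g \<in> borel_measurable borel"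
    by (rule borel_measurable_continuous_onI)
  have "(LINT p|rho_curvature. g p) = (LINT y|lborel. axis_curvature y * g (Complex 0 y))"
    unfolding rho_curvature_def using order_trans[OF zero_le_numeral axis_curvature_bounds(1)]
    by (subst integral_distr, simp_all, subst integral_density) auto
  then show "signed_integral (null_measure borel, rho_curvature) (fst c) (\<lambda>p. g (snd c p))
      = - (LINT z|lborel. ln (density rho_plane c z) * laplacian g z)"
    using weak_laplacian_ln_rho[OF g] by (simp add: signed_integral_def set_lebesgue_integral_def c)
qed

section \<open>Distances\<close>

text \<open>After clearing denominators and squaring, the two sides differ by
  \<open>(x\<^sup>2 + 2 \<bar>x\<bar>) y\<^sup>2\<close>. This compares slopes such as that of
  \<open>arsinh\<close> with \<open>rho\<close>.\<close>

lemma inverse_sqrt_le_rad: "1 / sqrt (1 + (Im z)\<^sup>2) \<le> (1 + \<bar>Re z\<bar>) / rad z"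
proof -
  have "(1 + \<bar>Re z\<bar>)\<^sup>2 * (1 + (Im z)\<^sup>2) = (1 + \<bar>Re z\<bar>)\<^sup>2 + (Im z)\<^sup>2 + (\<bar>Re z\<bar>\<^sup>2 + 2 * \<bar>Re z\<bar>) * (Im z)\<^sup>2"
    by (simp add: power2_eq_square algebra_simps)
  then have "(1 + \<bar>Re z\<bar>)\<^sup>2 + (Im z)\<^sup>2 \<le> (1 + \<bar>Re z\<bar>)\<^sup>2 * (1 + (Im z)\<^sup>2)"
    by (simp add: mult_nonneg_nonneg)
  then have "rad z \<le> sqrt ((1 + \<bar>Re z\<bar>)\<^sup>2 * (1 + (Im z)\<^sup>2))"
    unfolding rad_def by (rule real_sqrt_le_mono)
  also have "\<dots> = (1 + \<bar>Re z\<bar>) * sqrt (1 + (Im z)\<^sup>2)"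
    by (simp add: real_sqrt_mult)
  finally have "rad z \<le> (1 + \<bar>Re z\<bar>) * sqrt (1 + (Im z)\<^sup>2)" .
  moreover have "0 < sqrt (1 + (Im z)\<^sup>2)"
    by (simp add: add_pos_nonneg)
  ultimately show ?thesis
    using rad_ge_1[of z] by (simp add: divide_simps mult.commute)
qed

lemma one_plus_le_exp:
  assumes "0 \<le> (a :: real)"
  shows "1 + 2 * a \<le> exp (2 * a)" "(1 + a)\<^sup>2 \<le> exp (2 * a)"
proof -
  show "1 + 2 * a \<le> exp (2 * a)" by (rule exp_ge_add_one_self)
  have "(1 + a)\<^sup>2 \<le> (exp a)\<^sup>2"
    using exp_ge_add_one_self[of a] assms by (intro power_mono) auto
  then show "(1 + a)\<^sup>2 \<le> exp (2 * a)" by (simp add: exp_double)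
qed

text \<open>The first coordinate for completeness. Its slope \<open>1 / sqrt (1 + y\<^sup>2)\<close>
  is at most \<open>(1 + \<bar>x\<bar>) / rad z\<close>, and the exponential in \<open>rho\<close>
  absorbs the numerator.\<close>

lemma arsinh_Im_lipschitz: "\<bar>arsinh (Im q) - arsinh (Im p)\<bar> \<le> rho.plane_dist p q"
proof (rule rho.lipschitz_le_plane_dist[where \<Phi> = "\<lambda>z. arsinh (Im z)"
      and \<Phi>' = "\<lambda>z v. Im v * (1 / sqrt ((Im z)\<^sup>2 + 1))"])
  fix z v :: complex
  show "((\<lambda>z. arsinh (Im z)) has_derivative (\<lambda>v. Im v * (1 / sqrt ((Im z)\<^sup>2 + 1)))) (at z)"
    by (intro DERIV_compose_FDERIV arsinh_real_has_field_derivative derivative_intros)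
  have "\<bar>Im v * (1 / sqrt ((Im z)\<^sup>2 + 1))\<bar> \<le> norm v * (1 / sqrt (1 + (Im z)\<^sup>2))"
    using abs_Im_le_cmod[of v] by (simp add: abs_mult divide_right_mono add.commute)
  also have "\<dots> \<le> norm v * ((1 + \<bar>Re z\<bar>) / rad z)"
    by (intro mult_left_mono inverse_sqrt_le_rad) simp
  also have "\<dots> \<le> norm v * rho z"
    unfolding rho_def
    using rad_ge_1[of z] one_plus_le_exp(1)[of "\<bar>Re z\<bar>"] abs_ge_zero[of "Re z"] norm_ge_zero[of v]
    by (intro mult_left_mono divide_right_mono) linarith+
  finally show "\<bar>Im v * (1 / sqrt ((Im z)\<^sup>2 + 1))\<bar> \<le> rho z * norm v"
    by (simp add: mult.commute)
qed

text \<open>The second coordinate. The weight \<open>w\<close> compensates for the decay of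
  \<open>rho\<close> in \<open>y\<close>. Since \<open>w\<close> is 1-Lipschitz and at least 1, the
  gradient is at most \<open>(1 + \<bar>x\<bar>) / (2 w)\<close>; with
  \<open>inverse_sqrt_le_rad\<close> a second factor \<open>1 + \<bar>x\<bar>\<close> appears, and
  the exponential absorbs the square.\<close>

lemma Re_scaled_lipschitz:
  "\<bar>Re q / (2 * sqrt (1 + (Im q)\<^sup>2)) - Re p / (2 * sqrt (1 + (Im p)\<^sup>2))\<bar> \<le> rho.plane_dist p q"
proof -
  define w where "w z = sqrt (1 + (Im z)\<^sup>2)" for z
  define w' where "w' z v = Im z * Im v / w z" for z v
  have w1: "1 \<le> w z" for z by (simp add: w_def)
  have dw: "(w has_derivative w' z) (at z)" for z
  proof -
    have pos: "0 < 1 + (Im z)\<^sup>2"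
      by (simp add: add_pos_nonneg)
    have "((\<lambda>z. 1 + (Im z)\<^sup>2) has_derivative (\<lambda>v. 2 * Im z * Im v)) (at z)"
      by (auto intro!: derivative_eq_intros)
    from DERIV_compose_FDERIV[OF DERIV_real_sqrt[OF pos] this]
    have "(w has_derivative (\<lambda>v. 2 * Im z * Im v * (inverse (sqrt (1 + (Im z)\<^sup>2)) / 2))) (at z)"
      unfolding w_def[abs_def] .
    also have "(\<lambda>v. 2 * Im z * Im v * (inverse (sqrt (1 + (Im z)\<^sup>2)) / 2)) = w' z"
      by (simp add: w'_def w_def fun_eq_iff field_simps)
    finally show ?thesis .
  qed
  define \<Phi>' where "\<Phi>' z v = (Re v * (2 * w z) - Re z * (2 * w' z v)) / (2 * w z * (2 * w z))" for z v
  have "\<bar>Re q / (2 * w q) - Re p / (2 * w p)\<bar> \<le> rho.plane_dist p q"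
  proof (rule rho.lipschitz_le_plane_dist[where \<Phi>' = \<Phi>'])
    fix z v :: complex
    have "2 * w z \<noteq> 0" using w1[of z] by simp
    then show "((\<lambda>z. Re z / (2 * w z)) has_derivative \<Phi>' z) (at z)"
      unfolding \<Phi>'_def[abs_def]
      by (intro has_derivative_divide' derivative_intros has_derivative_mult_right dw)
    have "\<bar>Im z\<bar> \<le> w z"
      unfolding w_def by (rule real_le_rsqrt) simp
    then have "\<bar>Im z / w z\<bar> \<le> 1"
      using w1[of z] by (simp add: divide_simps)
    then have w': "\<bar>w' z v\<bar> \<le> norm v"
      using mult_mono[of "\<bar>Im z / w z\<bar>" 1 "\<bar>Im v\<bar>" "norm v"] abs_Im_le_cmod[of v]
      by (simp add: w'_def abs_mult)
    have "\<bar>Re z * (2 * w' z v)\<bar> \<le> \<bar>Re z\<bar> * (2 * norm v)"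
      unfolding abs_mult using w' by (intro mult_left_mono) auto
    also have "\<dots> \<le> \<bar>Re z\<bar> * (2 * norm v) * w z"
      using mult_left_mono[OF w1[of z], of "\<bar>Re z\<bar> * (2 * norm v)"] by simp
    finally have 1: "\<bar>Re z * (2 * w' z v)\<bar> \<le> \<bar>Re z\<bar> * norm v * (2 * w z)"
      by (simp add: mult_ac)
    have 2: "\<bar>Re v * (2 * w z)\<bar> \<le> norm v * (2 * w z)"
      using abs_Re_le_cmod[of v] w1[of z] by (simp add: abs_mult mult_right_mono)
    have "\<bar>\<Phi>' z v\<bar> \<le> ((1 + \<bar>Re z\<bar>) * norm v * (2 * w z)) / (2 * w z * (2 * w z))"
      unfolding \<Phi>'_def abs_divide
      using 1 2 abs_triangle_ineq4[of "Re v * (2 * w z)" "Re z * (2 * w' z v)"] w1[of z]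
      by (intro frac_le) (auto simp: algebra_simps)
    also have "\<dots> = (1 + \<bar>Re z\<bar>) / 2 * norm v * (1 / w z)"
      using w1[of z] by (simp add: field_simps)
    also have "\<dots> \<le> (1 + \<bar>Re z\<bar>) / 2 * norm v * ((1 + \<bar>Re z\<bar>) / rad z)"
      unfolding w_def by (intro mult_left_mono inverse_sqrt_le_rad) auto
    also have "\<dots> = (1 + \<bar>Re z\<bar>)\<^sup>2 / 2 * (norm v / rad z)"
      by (simp add: power2_eq_square)
    also have "\<dots> \<le> exp (2 * \<bar>Re z\<bar>) * (norm v / rad z)"
      using one_plus_le_exp(2)[of "\<bar>Re z\<bar>"] rad_ge_1[of z] zero_le_power2[of "1 + \<bar>Re z\<bar>"]
      by (intro mult_right_mono) (linarith, simp)
    finally show "\<bar>\<Phi>' z v\<bar> \<le> rho z * norm v"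
      by (simp add: rho_def mult_ac)
  qed
  then show ?thesis by (simp add: w_def)
qed

lemma complete_rho_plane: "complete_surface rho_plane" and Metric_space_rho_plane: "Metric_space UNIV rho.plane_dist"
proof -
  \<comment> \<open>If \<open>s\<close> is the first coordinate, then \<open>y = sinh s\<close> and
    \<open>sqrt (1 + y\<^sup>2) = cosh s\<close>.\<close>
  let ?G = "\<lambda>p. Complex (2 * snd p * cosh (fst p)) (sinh (fst p))"
  have G: "continuous_on UNIV ?G"
    unfolding complex_eq by (intro continuous_intros)
  have *: "?G (arsinh (Im z), Re z / (2 * sqrt (1 + (Im z)\<^sup>2))) = z" for z
  proof -
    have "0 < 1 + (Im z)\<^sup>2" by (simp add: add_pos_nonneg)
    then show ?thesis
      by (simp add: complex_eq_iff cosh_arsinh_real add.commute)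
  qed
  show "complete_surface rho_plane" "Metric_space UNIV rho.plane_dist"
    using rho.complete_surface_plane[OF arsinh_Im_lipschitz Re_scaled_lipschitz G *] by auto
qed

text \<open>With \<open>E = exp (2 * \<bar>x\<bar>)\<close>, the available gradient
  \<open>E / rad z\<close> is shared out by \<open>E = 1 + (E - 1) / 2 + (E - 1) / 2\<close>. The
  \<open>arsinh\<close> term takes at most \<open>1 + \<bar>x\<bar>\<close>, which is within
  \<open>1 + (E - 1) / 2\<close>, and the quotient takes the rest. The sign \<open>\<sigma>\<close>
  stands in for the absolute value of \<open>arsinh\<close>, which is not differentiable at
  0.\<close>

lemma disc_lower_lipschitz:
  assumes "\<bar>\<sigma>\<bar> = 1"
  shows "\<sigma> * arsinh (Im z) + (cosh (2 * Re z) - 1) / (8 * sqrt (1 + (Re z)\<^sup>2 + (Im z)\<^sup>2))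
    \<le> rho.plane_dist 0 z"
proof -
  define w where "w z = sqrt (1 + (Re z)\<^sup>2 + (Im z)\<^sup>2)" for z
  define w' where "w' z v = (Re z * Re v + Im z * Im v) / w z" for z v
  have pos: "0 < 1 + (Re z)\<^sup>2 + (Im z)\<^sup>2" for z
    by (simp add: add_pos_nonneg)
  have w1: "1 \<le> w z" for z by (simp add: w_def)
  have dw: "(w has_derivative w' z) (at z)" for z
  proof -
    have "((\<lambda>z. 1 + (Re z)\<^sup>2 + (Im z)\<^sup>2) has_derivative (\<lambda>v. 2 * Re z * Re v + 2 * Im z * Im v)) (at z)"
      by (auto intro!: derivative_eq_intros)
    from DERIV_compose_FDERIV[OF DERIV_real_sqrt[OF pos] this]
    have "(w has_derivative (\<lambda>v. (2 * Re z * Re v + 2 * Im z * Im v)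
        * (inverse (sqrt (1 + (Re z)\<^sup>2 + (Im z)\<^sup>2)) / 2))) (at z)"
      unfolding w_def[abs_def] .
    also have "(\<lambda>v. (2 * Re z * Re v + 2 * Im z * Im v)
        * (inverse (sqrt (1 + (Re z)\<^sup>2 + (Im z)\<^sup>2)) / 2)) = w' z"
      by (rule ext) (simp add: w'_def w_def inverse_eq_divide add_divide_distrib distrib_right)
    finally show ?thesis .
  qed
  define n where "n z = cosh (2 * Re z) - 1" for z
  have n0: "0 \<le> n z" for z using cosh_real_ge_1[of "2 * Re z"] by (simp add: n_def)
  define n' where "n' z v = 2 * Re v * sinh (2 * Re z)" for z v
  have dn: "(n has_derivative n' z) (at z)" for z
  proof -
    have "((\<lambda>x. cosh x - 1) has_real_derivative sinh (2 * Re z)) (at (2 * Re z))"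
      by (auto intro!: derivative_eq_intros)
    moreover have "((\<lambda>z. 2 * Re z) has_derivative (\<lambda>v. 2 * Re v)) (at z)"
      by (auto intro!: derivative_eq_intros)
    ultimately show ?thesis
      unfolding n_def[abs_def] n'_def[abs_def]
      by (rule DERIV_compose_FDERIV[where g = "\<lambda>z. 2 * Re z"])
  qed
  define \<Phi> where "\<Phi> z = \<sigma> * arsinh (Im z) + n z / (8 * w z)" for z
  define \<Phi>' where "\<Phi>' z v = \<sigma> * (Im v * (1 / sqrt ((Im z)\<^sup>2 + 1)))
      + (n' z v * (8 * w z) - n z * (8 * w' z v)) / (8 * w z * (8 * w z))" for z v
  have "\<bar>\<Phi> z - \<Phi> 0\<bar> \<le> rho.plane_dist 0 z"
  proof (rule rho.lipschitz_le_plane_dist[where \<Phi>' = \<Phi>'])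
    fix z v :: complex
    have nz: "8 * w z \<noteq> 0" using w1[of z] by simp
    then show "(\<Phi> has_derivative \<Phi>' z) (at z)"
      unfolding \<Phi>_def[abs_def] \<Phi>'_def[abs_def]
      by (intro has_derivative_add has_derivative_divide' has_derivative_mult_right dw dn
          DERIV_compose_FDERIV arsinh_real_has_field_derivative derivative_intros)
    define E where "E = exp (2 * \<bar>Re z\<bar>)"
    have "norm z \<le> w z"
      unfolding w_def cmod_def by simp
    have "\<bar>Re z * Re v + Im z * Im v\<bar> \<le> norm z * norm v"
      using Cauchy_Schwarz_ineq2[of z v] by (simp add: inner_complex_def)
    also have "\<dots> \<le> w z * norm v"
      using \<open>norm z \<le> w z\<close> by (rule mult_right_mono) simp
    finally have w': "\<bar>w' z v\<bar> \<le> norm v"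
      using w1[of z] by (simp add: w'_def abs_divide divide_simps mult.commute)
    have "\<bar>n z * (8 * w' z v)\<bar> \<le> n z * (8 * norm v)"
      using w' n0[of z] by (simp add: abs_mult mult_left_mono)
    also have "\<dots> \<le> n z * (8 * norm v) * w z"
      using mult_left_mono[OF w1[of z], of "n z * (8 * norm v)"] n0[of z] by simp
    finally have 1: "\<bar>n z * (8 * w' z v)\<bar> \<le> n z * norm v * (8 * w z)"
      by (simp add: mult_ac)
    have "\<bar>n' z v\<bar> \<le> 2 * \<bar>sinh (2 * Re z)\<bar> * norm v"
      using mult_left_mono[OF abs_Re_le_cmod[of v], of "2 * \<bar>sinh (2 * Re z)\<bar>"]
      by (simp add: n'_def abs_mult mult_ac)
    then have 2: "\<bar>n' z v * (8 * w z)\<bar> \<le> 2 * \<bar>sinh (2 * Re z)\<bar> * norm v * (8 * w z)"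
      unfolding abs_mult[of "n' z v"] using w1[of z] by (intro mult_mono) auto
    \<comment> \<open>As \<open>E\<close> is the sum of \<open>sinh\<close> and \<open>cosh\<close>
      at \<open>2 * \<bar>Re z\<bar>\<close>, the sides differ by \<open>cosh - 1\<close>.\<close>
    have "2 * \<bar>sinh (2 * Re z)\<bar> + n z \<le> 2 * (E - 1)"
    proof -
      have *: "2 * s + (c - 1) \<le> 2 * (s + c - 1)" if "1 \<le> c" for s c :: real
        using that by simp
      have "\<bar>sinh (2 * Re z)\<bar> = sinh (2 * \<bar>Re z\<bar>)" "cosh (2 * Re z) = cosh (2 * \<bar>Re z\<bar>)"
        by (auto simp: abs_if)
      moreover have "E = sinh (2 * \<bar>Re z\<bar>) + cosh (2 * \<bar>Re z\<bar>)"
        by (simp add: E_def sinh_plus_cosh)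
      ultimately show ?thesis
        using * [OF cosh_real_ge_1[of "2 * \<bar>Re z\<bar>"]] by (simp only: n_def)
    qed
    then have sn: "(2 * \<bar>sinh (2 * Re z)\<bar> + n z) * (norm v * (8 * w z)) \<le> 2 * (E - 1) * (norm v * (8 * w z))"
      using w1[of z] by (intro mult_right_mono) auto
    have "2 * \<bar>sinh (2 * Re z)\<bar> * norm v * (8 * w z) + n z * norm v * (8 * w z)
        \<le> 2 * (E - 1) * (norm v * (8 * w z))"
      using sn by (simp only: distrib_right mult.assoc)
    with 1 2 have "\<bar>n' z v * (8 * w z) - n z * (8 * w' z v)\<bar> \<le> 2 * (E - 1) * (norm v * (8 * w z))"
      by (meson abs_triangle_ineq4 add_mono order_trans)
    then have "\<bar>n' z v * (8 * w z) - n z * (8 * w' z v)\<bar> / (8 * w z * (8 * w z))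
        \<le> (2 * (E - 1) * (norm v * (8 * w z))) / (8 * w z * (8 * w z))"
      using w1[of z] by (intro divide_right_mono) auto
    moreover have "\<bar>8 * w z * (8 * w z)\<bar> = 8 * w z * (8 * w z)"
      by (rule abs_of_nonneg) simp
    ultimately have "\<bar>(n' z v * (8 * w z) - n z * (8 * w' z v)) / (8 * w z * (8 * w z))\<bar>
        \<le> (2 * (E - 1) * (norm v * (8 * w z))) / (8 * w z * (8 * w z))"
      by (simp only: abs_divide)
    also have "\<dots> = (E - 1) / 2 * norm v * (1 / (2 * w z))"
      using w1[of z] by (simp add: field_simps)
    \<comment> \<open>Here \<open>rad z \<le> 2 * w z\<close>, by
      \<open>2 * \<bar>x\<bar> \<le> 1 + x\<^sup>2\<close>. The factor 8 in \<open>\<Phi>\<close> is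
      what leaves just half of \<open>E - 1\<close>.\<close>
    also have "\<dots> \<le> (E - 1) / 2 * norm v * (1 / rad z)"
    proof -
      have "(1 + \<bar>Re z\<bar>)\<^sup>2 + (Im z)\<^sup>2 \<le> 4 * (1 + (Re z)\<^sup>2 + (Im z)\<^sup>2)"
      proof -
        have "1 + a + 2 * c + b \<le> 4 * (1 + a + b)" if "2 * c \<le> 1 + a" "0 \<le> a" "0 \<le> b" for a b c :: real
          using that by simp
        from this[OF _ zero_le_power2 zero_le_power2] show ?thesis
          using sum_squares_bound[of 1 "\<bar>Re z\<bar>"]
          unfolding power2_sum power2_abs power_one mult_1_right by blast
      qed
      then have "rad z \<le> sqrt (4 * (1 + (Re z)\<^sup>2 + (Im z)\<^sup>2))"
        unfolding rad_def by (rule real_sqrt_le_mono)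
      also have "\<dots> = 2 * w z"
        unfolding real_sqrt_mult w_def by simp
      finally show ?thesis
        using rad_ge_1[of z] one_plus_le_exp(1)[of "\<bar>Re z\<bar>"]
        by (intro mult_left_mono) (auto simp: E_def divide_simps)
    qed
    finally have 3: "\<bar>(n' z v * (8 * w z) - n z * (8 * w' z v)) / (8 * w z * (8 * w z))\<bar>
        \<le> (E - 1) / 2 / rad z * norm v" by (simp add: mult_ac)
    have "\<bar>\<sigma> * (Im v * (1 / sqrt ((Im z)\<^sup>2 + 1)))\<bar> \<le> norm v * (1 / sqrt (1 + (Im z)\<^sup>2))"
      using abs_Im_le_cmod[of v] assms by (simp add: abs_mult divide_right_mono add.commute)
    also have "\<dots> \<le> norm v * ((1 + \<bar>Re z\<bar>) / rad z)"
      by (intro mult_left_mono inverse_sqrt_le_rad) simp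
    finally have 4: "\<bar>\<sigma> * (Im v * (1 / sqrt ((Im z)\<^sup>2 + 1)))\<bar> \<le> (1 + \<bar>Re z\<bar>) / rad z * norm v"
      by (simp add: mult_ac)
    have "\<bar>\<Phi>' z v\<bar> \<le> (1 + \<bar>Re z\<bar>) / rad z * norm v + (E - 1) / 2 / rad z * norm v"
      unfolding \<Phi>'_def using 3 4 by (intro abs_triangle_ineq[THEN order_trans] add_mono)
    also have "\<dots> = ((1 + \<bar>Re z\<bar> + (E - 1) / 2) / rad z) * norm v"
      by (simp add: add_divide_distrib distrib_right)
    also have "\<dots> \<le> rho z * norm v"
    proof -
      have "1 + c + (e - 1) / 2 \<le> e" if "1 + 2 * c \<le> e" for c e :: real
        using that by (simp add: field_simps)
      from this[OF one_plus_le_exp(1)[OF abs_ge_zero]] show ?thesis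
        unfolding rho_def E_def using rad_ge_1[of z]
        by (intro mult_right_mono divide_right_mono) auto
    qed
    finally show "\<bar>\<Phi>' z v\<bar> \<le> rho z * norm v" .
  qed
  moreover have "\<Phi> 0 = 0"
    by (simp add: \<Phi>_def n_def)
  ultimately show ?thesis
    by (simp add: \<Phi>_def n_def w_def)
qed

section \<open>Discs about the origin\<close>

lemma disc_rho_plane: "disc rho_plane 0 r = {z. rho.plane_dist 0 z < r}"
proof -
  interpret M: Metric_space UNIV rho.plane_dist by (rule Metric_space_rho_plane)
  show ?thesis by (auto simp: disc_def M.mball_def)
qed

lemma disc_measurable: "disc rho_plane 0 r \<in> sets borel"
proof -
  have "open {z. rho.plane_dist 0 z < r}"
    by (intro open_Collect_less rho.continuous_plane_dist continuous_on_const)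
  then show ?thesis by (simp add: disc_rho_plane)
qed

text \<open>Both signs in \<open>disc_lower_lipschitz\<close> together give
  \<open>\<bar>arsinh (Im z)\<bar> + n / (8 * w) < r\<close>. As
  \<open>exp (2 * \<bar>x\<bar>) \<le> 2 + 2 * n\<close> and \<open>w \<le> rad z\<close>,
  \<open>rho\<close> is at most \<open>2\<close> plus 16 times the remaining radius.\<close>

lemma
  assumes "z \<in> disc rho_plane 0 r"
  shows disc_imp_arsinh_less: "\<bar>arsinh (Im z)\<bar> < r"
    and disc_imp_rho_le: "rho z \<le> 2 + 16 * (r - \<bar>arsinh (Im z)\<bar>)"
proof -
  define n where "n = cosh (2 * Re z) - 1"
  define w where "w = sqrt (1 + (Re z)\<^sup>2 + (Im z)\<^sup>2)"
  have n0: "0 \<le> n" by (simp add: n_def cosh_real_ge_1)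
  have w1: "1 \<le> w" by (simp add: w_def)
  have "arsinh (Im z) + n / (8 * w) < r" "- arsinh (Im z) + n / (8 * w) < r"
    using assms disc_lower_lipschitz[of 1 z] disc_lower_lipschitz[of "-1" z]
    by (simp_all add: disc_rho_plane n_def w_def)
  then have *: "\<bar>arsinh (Im z)\<bar> + n / (8 * w) < r" by linarith
  moreover have "0 \<le> n / (8 * w)" using n0 w1 by simp
  ultimately show "\<bar>arsinh (Im z)\<bar> < r" by linarith
  have "w \<le> rad z"
    unfolding w_def rad_def by (rule real_sqrt_le_mono) (simp add: power2_eq_square algebra_simps)
  then have "n / (8 * rad z) \<le> n / (8 * w)"
    using n0 w1 by (intro divide_left_mono) auto
  then have "2 * n / rad z \<le> 16 * (r - \<bar>arsinh (Im z)\<bar>)"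
    using * by simp
  moreover have "exp (2 * \<bar>Re z\<bar>) \<le> 2 + 2 * n"
    by (auto simp: n_def cosh_def abs_if)
  then have "rho z \<le> (2 + 2 * n) / rad z"
    unfolding rho_def using rad_ge_1[of z] by (intro divide_right_mono) auto
  moreover have "2 / rad z \<le> 2"
    using rad_ge_1[of z] by (simp add: divide_simps)
  ultimately show "rho z \<le> 2 + 16 * (r - \<bar>arsinh (Im z)\<bar>)"
    by (simp add: add_divide_distrib)
qed

text \<open>On the axis \<open>rho\<close> is the derivative of \<open>arsinh\<close>, so the
  straight segment from 0 has this length.\<close>

lemma plane_dist_axis_le: "rho.plane_dist 0 (Complex 0 y) \<le> arsinh \<bar>y\<bar>"
proof -
  have der: "((\<lambda>t. Complex 0 (y * t)) has_vector_derivative Complex 0 y) (at t)" for t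
  proof -
    have "((\<lambda>t. of_real t * Complex 0 y) has_vector_derivative Complex 0 y) (at t)"
      by (auto intro!: derivative_eq_intros has_vector_derivative_mult_left simp: has_vector_derivative_def scaleR_conv_of_real)
    also have "(\<lambda>t. of_real t * Complex 0 y) = (\<lambda>t. Complex 0 (y * t))"
      by (auto simp: complex_eq_iff)
    finally show ?thesis .
  qed
  let ?h = "\<lambda>t. \<bar>y\<bar> * (1 / sqrt ((\<bar>y\<bar> * t)\<^sup>2 + 1))"
  have "((\<lambda>t. arsinh (\<bar>y\<bar> * t)) has_real_derivative (1 / sqrt ((\<bar>y\<bar> * t)\<^sup>2 + 1)) * \<bar>y\<bar>) (at t within {0..1})" for t
    by (rule DERIV_chain2[OF arsinh_real_has_field_derivative]) (auto intro!: derivative_eq_intros)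
  then have h: "(?h has_integral arsinh (\<bar>y\<bar> * 1) - arsinh (\<bar>y\<bar> * 0)) {0..1}"
    by (intro fundamental_theorem_of_calculus)
      (auto simp: has_real_derivative_iff_has_vector_derivative[symmetric] mult.commute)
  have s: "rho (Complex 0 (y * t)) * norm (Complex 0 y) \<le> ?h t" for t
    by (simp add: rho_def rad_def power_mult_distrib add.commute cmod_def)
  have "valid_path (\<lambda>t. Complex 0 (y * t))"
    "rho.plane_length (\<lambda>t. Complex 0 (y * t)) \<le> ennreal (arsinh (\<bar>y\<bar> * 1) - arsinh (\<bar>y\<bar> * 0))"
    using rho.plane_length_C1_le[OF der continuous_on_const s h] by auto
  then show ?thesis
    by (intro rho.plane_dist_le[of "\<lambda>t. Complex 0 (y * t)"])
      (auto simp: pathstart_def pathfinish_def complex_eq_iff less_imp_le order_le_less)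
qed

section \<open>Area and curvature of discs\<close>

text \<open>The pointwise bound counts the origin twice, which is harmless for an upper
  estimate.\<close>

lemma nn_integral_abs_le:
  fixes f :: "real \<Rightarrow> ennreal"
  assumes [measurable]: "f \<in> borel_measurable borel"
  shows "(\<integral>\<^sup>+x. f \<bar>x\<bar> \<partial>lborel) \<le> 2 * (\<integral>\<^sup>+x\<in>{0..}. f x \<partial>lborel)"
proof -
  define h where "h x = f x * indicator {0..} x" for x
  have [measurable]: "h \<in> borel_measurable borel"
    unfolding h_def[abs_def] by measurable
  have "(\<integral>\<^sup>+x. f \<bar>x\<bar> \<partial>lborel) \<le> (\<integral>\<^sup>+x. h x + h (0 + (-1) * x) \<partial>lborel)"
    by (rule nn_integral_mono) (auto simp: h_def indicator_def abs_if)
  also have "\<dots> = (\<integral>\<^sup>+x. h x \<partial>lborel) + (\<integral>\<^sup>+x. h (0 + (-1) * x) \<partial>lborel)"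
    by (rule nn_integral_add) simp_all
  also have "(\<integral>\<^sup>+x. h (0 + (-1) * x) \<partial>lborel) = (\<integral>\<^sup>+x. h x \<partial>lborel)"
    using nn_integral_real_affine[of h "-1" 0] by simp
  finally show ?thesis by (simp add: h_def mult_2)
qed

text \<open>The function increases, so the sublevel set is an interval ending at the point
  \<open>X\<close> where \<open>q\<close> reaches \<open>m\<close>. From
  \<open>q \<le> q' / 2\<close> the integral up to \<open>X\<close> is at most
  \<open>(q X - q 0) / 2\<close>, however long the interval is.\<close>

lemma nn_integral_sublevel_le:
  fixes q q' :: "real \<Rightarrow> real"
  assumes d: "\<And>x. x \<ge> 0 \<Longrightarrow> (q has_real_derivative q' x) (at x)"
    and pos: "\<And>x. x \<ge> 0 \<Longrightarrow> 0 < q x" and ge: "\<And>x. x \<ge> 0 \<Longrightarrow> 2 * q x \<le> q' x"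
  shows "(\<integral>\<^sup>+x\<in>{x. 0 \<le> x \<and> q x \<le> m}. ennreal (q x) \<partial>lborel) \<le> ennreal (m / 2)"
proof (cases "q 0 \<le> m")
  case False
  have less: "m < q x" if "0 \<le> x" for x
  proof -
    have "q 0 \<le> q x"
    proof (rule DERIV_nonneg_imp_nondecreasing[OF that])
      fix t :: real assume "0 \<le> t"
      then have "0 \<le> q' t" using pos[of t] ge[of t] by linarith
      then show "\<exists>y. (q has_real_derivative y) (at t) \<and> 0 \<le> y"
        using d[OF \<open>0 \<le> t\<close>] by blast
    qed
    then show ?thesis using False by simp
  qed
  then have "{x. 0 \<le> x \<and> q x \<le> m} = {}" by (auto simp: not_le[symmetric])
  then show ?thesis by simp
next
  case True
  have q0: "0 < q 0" using pos by simp
  have mono: "q a < q b" if "0 \<le> a" "a < b" for a b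
  proof (rule DERIV_pos_imp_increasing[OF \<open>a < b\<close>])
    fix t :: real assume "a \<le> t"
    then have "0 < q' t" "0 \<le> t" using that pos[of t] ge[of t] by linarith+
    then show "\<exists>y. (q has_real_derivative y) (at t) \<and> 0 < y"
      using d by blast
  qed
  have le: "q 0 \<le> q x" if "0 \<le> x" for x
    using mono[of 0 x] that by (cases "x = 0") auto
  \<comment> \<open>The slope is at least \<open>2 * q 0\<close>, so up to \<open>b\<close> the
    function grows by at least \<open>m\<close>; this supplies the right end for the intermediate
    value theorem.\<close>
  define b where "b = m / (2 * q 0)"
  have b: "0 \<le> b" using True q0 by (simp add: b_def)
  have "q 0 - 2 * q 0 * 0 \<le> q b - 2 * q 0 * b"
  proof (rule DERIV_nonneg_imp_nondecreasing[OF b])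
    fix t :: real assume "0 \<le> t"
    then have "((\<lambda>x. q x - 2 * q 0 * x) has_real_derivative q' t - 2 * q 0) (at t)"
      using d by (auto intro!: derivative_eq_intros)
    moreover have "0 \<le> q' t - 2 * q 0"
      using ge[of t] le[of t] \<open>0 \<le> t\<close> by linarith
    ultimately show "\<exists>y. ((\<lambda>x. q x - 2 * q 0 * x) has_real_derivative y) (at t) \<and> 0 \<le> y"
      by blast
  qed
  then have "m \<le> q b" using q0 by (simp add: b_def)
  have cont: "continuous_on {0..c} q" for c
    by (rule DERIV_continuous_on[of _ _ q']) (simp add: d has_field_derivative_at_within)
  obtain X where X: "0 \<le> X" "q X = m"
    using IVT'[of q 0 m b] True \<open>m \<le> q b\<close> b cont by blast
  have i: "q integrable_on {0..X}"
    by (rule integrable_continuous_interval[OF cont])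
  have "(q' has_integral q X - q 0) {0..X}"
    by (rule fundamental_theorem_of_calculus[OF X(1)])
       (auto simp: has_real_derivative_iff_has_vector_derivative[symmetric] intro!: has_field_derivative_at_within d)
  then have "((\<lambda>x. 1 / 2 * q' x) has_integral 1 / 2 * (q X - q 0)) {0..X}"
    by (rule has_integral_mult_right)
  then have I: "integral {0..X} q \<le> 1 / 2 * (q X - q 0)"
  proof (rule has_integral_le[OF integrable_integral[OF i]])
    show "q x \<le> 1 / 2 * q' x" if "x \<in> {0..X}" for x
      using ge[of x] that by simp
  qed
  have "(\<integral>\<^sup>+x\<in>{x. 0 \<le> x \<and> q x \<le> m}. ennreal (q x) \<partial>lborel)
      \<le> (\<integral>\<^sup>+x. ennreal (indicator {0..X} x * q x) \<partial>lborel)"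
  proof (rule nn_integral_mono)
    fix x
    have "x \<le> X" if "0 \<le> x" "q x \<le> m"
      using mono[of X x] X that by force
    then show "ennreal (q x) * indicator {x. 0 \<le> x \<and> q x \<le> m} x \<le> ennreal (indicator {0..X} x * q x)"
      by (auto simp: indicator_def)
  qed
  also have "\<dots> = ennreal (integral {0..X} q)"
    using nn_integral_has_integral_lebesgue[OF _ integrable_integral[OF i]] pos
    by (simp add: less_imp_le)
  also have "\<dots> \<le> ennreal (m / 2)"
    using I X q0 by (intro ennreal_leI) simp
  finally show ?thesis .
qed

text \<open>The square of \<open>rho\<close> is \<open>q \<bar>x\<bar>\<close> with
  \<open>q x = exp (4 * x) / p x\<close>. Its logarithmic derivative
  \<open>4 - 2 * (1 + x) / p x\<close> is at least 2, since \<open>1 + x \<le> p x\<close>. Each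
  half line thus contributes at most \<open>B\<^sup>2 / 2\<close>.\<close>

lemma nn_integral_rho_sublevel_le:
  assumes "0 \<le> B"
  shows "(\<integral>\<^sup>+x\<in>{x. rho (Complex x y) \<le> B}. ennreal ((rho (Complex x y))\<^sup>2) \<partial>lborel) \<le> ennreal (B\<^sup>2)"
proof -
  define p where "p x = (1 + x)\<^sup>2 + y\<^sup>2" for x :: real
  define q where "q x = exp (4 * x) / p x" for x
  have [measurable]: "q \<in> borel_measurable borel"
    unfolding q_def[abs_def] p_def[abs_def] by measurable
  have p1: "(1 + x)\<^sup>2 \<le> p x" "1 + x \<le> p x" "1 \<le> p x" if "0 \<le> x" for x
  proof -
    show *: "(1 + x)\<^sup>2 \<le> p x" by (simp add: p_def)
    have "1 + x \<le> (1 + x)\<^sup>2" using that by (simp add: power2_eq_square algebra_simps)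
    then show "1 + x \<le> p x" "1 \<le> p x" using * that by linarith+
  qed
  have rho2: "(rho (Complex x y))\<^sup>2 = q \<bar>x\<bar>" for x
    using rad_sq_pos[of x y]
    by (simp add: rho_def rad_def q_def p_def power_divide exp_double[symmetric])
  have B: "rho (Complex x y) \<le> B \<longleftrightarrow> q \<bar>x\<bar> \<le> B\<^sup>2" for x
    unfolding rho2[symmetric] using assms rho_pos[of "Complex x y"]
    by (auto simp: power2_le_iff_abs_le)
  have "(\<integral>\<^sup>+x\<in>{x. rho (Complex x y) \<le> B}. ennreal ((rho (Complex x y))\<^sup>2) \<partial>lborel)
      = (\<integral>\<^sup>+x. ennreal (q \<bar>x\<bar>) * indicator {x. q x \<le> B\<^sup>2} \<bar>x\<bar> \<partial>lborel)"
    by (intro nn_integral_cong) (simp add: B rho2 indicator_def)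
  also have "\<dots> \<le> 2 * (\<integral>\<^sup>+x\<in>{0..}. ennreal (q x) * indicator {x. q x \<le> B\<^sup>2} x \<partial>lborel)"
    by (rule nn_integral_abs_le[where f = "\<lambda>x. ennreal (q x) * indicator {x. q x \<le> B\<^sup>2} x"]) measurable
  also have "(\<integral>\<^sup>+x\<in>{0..}. ennreal (q x) * indicator {x. q x \<le> B\<^sup>2} x \<partial>lborel)
      = (\<integral>\<^sup>+x\<in>{x. 0 \<le> x \<and> q x \<le> B\<^sup>2}. ennreal (q x) \<partial>lborel)"
    by (intro nn_integral_cong) (auto simp: indicator_def)
  also have "\<dots> \<le> ennreal (B\<^sup>2 / 2)"
  proof (rule nn_integral_sublevel_le)
    fix x :: real assume x: "0 \<le> x"
    show "0 < q x" using p1(3)[OF x] by (simp add: q_def)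
    have "(p has_real_derivative 2 * (1 + x)) (at x)"
      unfolding p_def[abs_def] by (auto intro!: derivative_eq_intros)
    moreover have "((\<lambda>x. exp (4 * x)) has_real_derivative 4 * exp (4 * x)) (at x)"
      by (auto intro!: derivative_eq_intros)
    ultimately show "(q has_real_derivative
        (4 * exp (4 * x) * p x - exp (4 * x) * (2 * (1 + x))) / (p x * p x)) (at x)"
      unfolding q_def[abs_def] using p1(3)[OF x] by (intro DERIV_divide) auto
    have "2 * q x = (exp (4 * x) * (2 * p x)) / (p x * p x)"
      using p1(3)[OF x] by (simp add: q_def)
    also have "\<dots> \<le> (exp (4 * x) * (4 * p x - 2 * (1 + x))) / (p x * p x)"
      using p1(2)[OF x] by (intro divide_right_mono mult_left_mono) auto
    finally show "2 * q x \<le> (4 * exp (4 * x) * p x - exp (4 * x) * (2 * (1 + x))) / (p x * p x)"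
      by (simp add: algebra_simps)
  qed
  finally have "(\<integral>\<^sup>+x\<in>{x. rho (Complex x y) \<le> B}. ennreal ((rho (Complex x y))\<^sup>2) \<partial>lborel)
      \<le> 2 * ennreal (B\<^sup>2 / 2)"
    by (simp add: mult_left_mono)
  also have "2 * ennreal (B\<^sup>2 / 2) = ennreal (2 * (B\<^sup>2 / 2))"
    by (subst ennreal_mult) simp_all
  finally show ?thesis by simp
qed

section \<open>Integration over the heights\<close>

lemma arsinh_abs: "\<bar>arsinh x\<bar> = arsinh \<bar>x :: real\<bar>"
  by (cases "x < 0") (auto simp: abs_if)

text \<open>For the remaining radius \<open>s\<close>,
  \<open>2 + 16 * s \<le> 64 * (1 + s / 4) \<le> 64 * exp (s / 4)\<close>, and 4096 is the square of
  64. The bound \<open>1 + y \<le> exp (arsinh y)\<close> makes this explicit in \<open>y\<close>.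
  The exponent \<open>s / 2\<close>, with a factor below 1, keeps the integral over \<open>y\<close>
  comparable to \<open>sinh r\<close>.\<close>

lemma square_le_sqrt_exp:
  assumes "0 \<le> (y :: real)" "arsinh y \<le> r"
  shows "(2 + 16 * (r - arsinh y))\<^sup>2 \<le> 4096 * (exp (r / 2) / sqrt (1 + y))"
proof -
  define s where "s = r - arsinh y"
  have s: "0 \<le> s" using assms by (simp add: s_def)
  have "2 + 16 * s \<le> 64 * (1 + s / 4)" using s by simp
  also have "\<dots> \<le> 64 * exp (s / 4)"
    by (intro mult_left_mono exp_ge_add_one_self) simp
  finally have "(2 + 16 * s)\<^sup>2 \<le> (64 * exp (s / 4))\<^sup>2"
    using s by (intro power_mono) auto
  also have "\<dots> = 4096 * exp (s / 2)"
    by (simp add: power_mult_distrib exp_double[symmetric])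
  also have "exp (s / 2) = exp (r / 2) / exp (arsinh y / 2)"
    by (simp add: s_def exp_diff[symmetric] diff_divide_distrib)
  also have "\<dots> \<le> exp (r / 2) / sqrt (1 + y)"
  proof -
    have "1 + y \<le> y + sqrt (y\<^sup>2 + 1)" by simp
    also have "\<dots> = exp (arsinh y)"
      using arsinh_real_aux[of y] by (simp add: arsinh_real_def)
    also have "\<dots> = (exp (arsinh y / 2))\<^sup>2"
      by (simp add: exp_double[symmetric])
    finally have "sqrt (1 + y) \<le> exp (arsinh y / 2)"
      by (intro real_le_lsqrt) auto
    then show ?thesis
      using assms by (intro divide_left_mono) auto
  qed
  finally show ?thesis by (simp add: s_def)
qed

text \<open>With \<open>t = sqrt (1 + sinh r)\<close> the integral is at most
  \<open>8192 * exp (r / 2) * (t - 1)\<close>. Since \<open>exp (r / 2) \<le> 2 * t\<close>, it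
  remains to use \<open>t * (t - 1) \<le> sinh r\<close>. The factor \<open>t - 1\<close> takes care
  of small \<open>r\<close>.\<close>

lemma nn_integral_inverse_sqrt_le:
  assumes "0 < r"
  shows "(\<integral>\<^sup>+y\<in>{0..<sinh r}. ennreal (4096 * (exp (r / 2) / sqrt (1 + y))) \<partial>lborel) \<le> ennreal (16384 * sinh r)"
proof -
  define S where "S = sinh r"
  have S: "0 < S" using assms by (simp add: S_def)
  let ?F = "\<lambda>y. 8192 * exp (r / 2) * sqrt (1 + y)"
  have "((\<lambda>y. 4096 * (exp (r / 2) / sqrt (1 + y))) has_integral ?F S - ?F 0) {0..S}"
  proof (rule fundamental_theorem_of_calculus)
    fix y assume "y \<in> {0..S}"
    then have "(?F has_real_derivative 4096 * (exp (r / 2) / sqrt (1 + y))) (at y)"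
      by (auto intro!: derivative_eq_intros simp: divide_simps)
    then show "(?F has_vector_derivative 4096 * (exp (r / 2) / sqrt (1 + y))) (at y within {0..S})"
      by (simp add: has_real_derivative_iff_has_vector_derivative has_vector_derivative_at_within)
  qed (use S in simp)
  from nn_integral_has_integral_lebesgue[OF _ this]
  have eq: "(\<integral>\<^sup>+y. ennreal (indicator {0..S} y * (4096 * (exp (r / 2) / sqrt (1 + y)))) \<partial>lborel)
      = ennreal (?F S - ?F 0)"
    by simp
  have le: "(\<integral>\<^sup>+y\<in>{0..<S}. ennreal (4096 * (exp (r / 2) / sqrt (1 + y))) \<partial>lborel)
      \<le> (\<integral>\<^sup>+y. ennreal (indicator {0..S} y * (4096 * (exp (r / 2) / sqrt (1 + y)))) \<partial>lborel)"
    by (intro nn_integral_mono) (auto simp: indicator_def)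
  have F: "?F S - ?F 0 \<le> 16384 * S"
  proof -
    define t where "t = sqrt (1 + S)"
    have t: "1 \<le> t" "t\<^sup>2 = 1 + S" using S by (auto simp: t_def)
    \<comment> \<open>This rests on \<open>2 * S = exp r - exp (- r)\<close> and
      \<open>exp (- r) \<le> 1\<close>.\<close>
    have "exp r \<le> 4 * (1 + S)"
    proof -
      have "a \<le> 4 * (1 + (a - b) / 2)" if "0 < a" "b \<le> 1" for a b :: real
        using that by (simp add: field_simps)
      from this[OF exp_gt_zero, of "exp (- r)"] show ?thesis
        unfolding S_def sinh_field_def using assms by simp
    qed
    then have "(exp (r / 2))\<^sup>2 \<le> (2 * t)\<^sup>2"
      by (simp add: power_mult_distrib t exp_double[symmetric])
    then have "exp (r / 2) \<le> 2 * t"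
      by (rule power2_le_imp_le) (use t(1) in simp)
    then have "exp (r / 2) * (t - 1) \<le> 2 * t * (t - 1)"
      using t(1) by (intro mult_right_mono) auto
    also have "\<dots> = 2 * t\<^sup>2 - 2 * t"
      by (simp add: power2_eq_square algebra_simps)
    also have "\<dots> \<le> 2 * S"
      using t(1) unfolding t(2) by simp
    finally show ?thesis
      by (simp add: t_def algebra_simps)
  qed
  show ?thesis
    using order_trans[OF le[unfolded eq] ennreal_leI[OF F]] unfolding S_def .
qed

section \<open>Comparison of area and curvature\<close>

definition rho_area :: "complex measure" where
  "rho_area = Nonnegative_Lebesgue_Integration.density lborel (\<lambda>z. ennreal ((rho z)\<^sup>2))"

text \<open>By Tonelli the disc is cut into horizontal slices. A slice is empty unless
  \<open>\<bar>y\<bar> < sinh r\<close>, and otherwise lies in a sublevel set of \<open>rho\<close>.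
  The two signs of \<open>y\<close> double 16384.\<close>

lemma emeasure_rho_area_disc_le:
  assumes "0 < r"
  shows "emeasure rho_area (disc rho_plane 0 r) \<le> ennreal (32768 * sinh r)"
proof -
  have [measurable]: "rho \<in> borel_measurable borel"
    by (rule borel_measurable_continuous_onI[OF rho_continuous])
  have [measurable]: "disc rho_plane 0 r \<in> sets borel"
    by (rule disc_measurable)
  define f where "f y = ennreal (4096 * (exp (r / 2) / sqrt (1 + y))) * indicator {0..<sinh r} y" for y
  have [measurable]: "f \<in> borel_measurable borel"
    unfolding f_def[abs_def] by measurable
  have slice: "(\<integral>\<^sup>+x. ennreal ((rho (Complex x y))\<^sup>2) * indicator (disc rho_plane 0 r) (Complex x y) \<partial>lborel) \<le> f \<bar>y\<bar>" for y
  proof (cases "\<bar>arsinh y\<bar> < r")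
    case False
    then have "Complex x y \<notin> disc rho_plane 0 r" for x
      using disc_imp_arsinh_less[of "Complex x y" r] by auto
    then show ?thesis by simp
  next
    case True
    then have a: "arsinh \<bar>y\<bar> < r" by (simp add: arsinh_abs)
    then have "\<bar>y\<bar> < sinh r"
      using sinh_real_less_iff[of "arsinh \<bar>y\<bar>" r] by simp
    \<comment> \<open>The bound of \<open>disc_imp_rho_le\<close>, which is constant along a
      slice.\<close>
    define B where "B = 2 + 16 * (r - arsinh \<bar>y\<bar>)"
    have "(\<integral>\<^sup>+x. ennreal ((rho (Complex x y))\<^sup>2) * indicator (disc rho_plane 0 r) (Complex x y) \<partial>lborel)
        \<le> (\<integral>\<^sup>+x\<in>{x. rho (Complex x y) \<le> B}. ennreal ((rho (Complex x y))\<^sup>2) \<partial>lborel)"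
      using disc_imp_rho_le[of "Complex _ y" r]
      by (intro nn_integral_mono) (auto simp: indicator_def B_def arsinh_abs)
    also have "\<dots> \<le> ennreal (B\<^sup>2)"
      using a by (intro nn_integral_rho_sublevel_le) (simp add: B_def)
    also have "\<dots> \<le> f \<bar>y\<bar>"
      using square_le_sqrt_exp[of "\<bar>y\<bar>" r] a \<open>\<bar>y\<bar> < sinh r\<close> by (simp add: f_def B_def ennreal_leI)
    finally show ?thesis .
  qed
  have "emeasure rho_area (disc rho_plane 0 r)
      = (\<integral>\<^sup>+y. \<integral>\<^sup>+x. ennreal ((rho (Complex x y))\<^sup>2) * indicator (disc rho_plane 0 r) (Complex x y) \<partial>lborel \<partial>lborel)"
    unfolding rho_area_def by (simp add: emeasure_density nn_integral_lborel_complex)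
  also have "\<dots> \<le> (\<integral>\<^sup>+y. f \<bar>y\<bar> \<partial>lborel)"
    by (intro nn_integral_mono slice)
  also have "\<dots> \<le> 2 * (\<integral>\<^sup>+y\<in>{0..}. f y \<partial>lborel)"
    by (rule nn_integral_abs_le) simp
  also have "(\<integral>\<^sup>+y\<in>{0..}. f y \<partial>lborel) = (\<integral>\<^sup>+y\<in>{0..<sinh r}. ennreal (4096 * (exp (r / 2) / sqrt (1 + y))) \<partial>lborel)"
    by (intro nn_integral_cong) (auto simp: f_def indicator_def)
  also have "\<dots> \<le> ennreal (16384 * sinh r)"
    by (rule nn_integral_inverse_sqrt_le[OF assms])
  finally have "emeasure rho_area (disc rho_plane 0 r) \<le> 2 * ennreal (16384 * sinh r)"
    by (simp add: mult_left_mono)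
  also have "\<dots> = ennreal (2 * (16384 * sinh r))"
    using assms by (subst ennreal_mult) auto
  finally show ?thesis by simp
qed

text \<open>On the axis the length of the segment and the lower bound by \<open>arsinh\<close>
  coincide, so the distance is known exactly.\<close>

lemma axis_in_disc_iff: "Complex 0 y \<in> disc rho_plane 0 r \<longleftrightarrow> \<bar>y\<bar> < sinh r"
proof -
  have "arsinh \<bar>y\<bar> < r \<longleftrightarrow> \<bar>y\<bar> < sinh r"
    using sinh_real_less_iff[of "arsinh \<bar>y\<bar>" r] by simp
  then show ?thesis
    using plane_dist_axis_le[of y] disc_imp_arsinh_less[of "Complex 0 y" r]
    by (auto simp: disc_rho_plane arsinh_abs)
qed

text \<open>The density is at least 2 on a segment of the axis of length
  \<open>2 * sinh r\<close>.\<close>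

lemma measure_rho_curvature_disc_ge:
  assumes "0 < r"
  shows "4 * sinh r \<le> measure rho_curvature (disc rho_plane 0 r)"
proof -
  define S where "S = sinh r"
  have S: "0 < S" using assms by (simp add: S_def)
  have eq: "emeasure rho_curvature (disc rho_plane 0 r) = (\<integral>\<^sup>+y. ennreal (axis_curvature y) * indicator {-S<..<S} y \<partial>lborel)"
    unfolding emeasure_rho_curvature[OF disc_measurable]
    by (intro nn_integral_cong) (auto simp: indicator_def axis_in_disc_iff S_def abs_less_iff)
  have const: "(\<integral>\<^sup>+y. ennreal c * indicator {-S<..<S} y \<partial>lborel) = ennreal (c * (2 * S))" if "0 \<le> c" for c
    using S that by (simp add: nn_integral_cmult_indicator ennreal_mult)
  \<comment> \<open>The upper bound is for finiteness: \<open>measure\<close> takes the value 0 on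
    sets of infinite measure.\<close>
  have "emeasure rho_curvature (disc rho_plane 0 r) \<le> (\<integral>\<^sup>+y. ennreal 4 * indicator {-S<..<S} y \<partial>lborel)"
    unfolding eq by (intro nn_integral_mono mult_right_mono ennreal_leI axis_curvature_bounds) simp
  also have "\<dots> = ennreal (4 * (2 * S))"
    by (rule const) simp
  finally have "emeasure rho_curvature (disc rho_plane 0 r) \<le> ennreal (4 * (2 * S))" .
  then have fin: "emeasure rho_curvature (disc rho_plane 0 r) = ennreal (measure rho_curvature (disc rho_plane 0 r))"
    by (intro emeasure_eq_ennreal_measure) (auto simp: top_unique)
  have "ennreal (2 * (2 * S)) = (\<integral>\<^sup>+y. ennreal 2 * indicator {-S<..<S} y \<partial>lborel)"
    by (rule const[symmetric]) simp
  also have "\<dots> \<le> emeasure rho_curvature (disc rho_plane 0 r)"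
    unfolding eq by (intro nn_integral_mono mult_right_mono ennreal_leI axis_curvature_bounds) simp
  finally have "ennreal (2 * (2 * S)) \<le> emeasure rho_curvature (disc rho_plane 0 r)" .
  then show ?thesis
    unfolding fin S_def by simp
qed

theorem mainTheorem5:
  shows "\<exists>(Y :: complex surface) \<alpha> \<kappa> a \<epsilon>.
    riemann_surface Y \<and> conformal_length_element Y \<and>
    area_measure Y \<alpha> \<and> curvature_measure Y \<kappa> \<and>
    simply_connected (points Y) \<and> complete_surface Y \<and> parabolic Y \<and>
    nonpositive_on (points Y) \<kappa> \<and>
    a \<in> points Y \<and> \<epsilon> > 0 \<and>
    (\<forall>r>0. signed_value \<kappa> (disc Y a r) < - \<epsilon> * measure \<alpha> (disc Y a r))"
proof (intro exI conjI allI impI)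
  show "simply_connected (points rho_plane)"
    using rho.parabolic_plane by (simp add: parabolic_def)
  show "area_measure rho_plane rho_area"
    unfolding rho_area_def by (rule rho.area_measure_plane)
  \<comment> \<open>The first component is null, so signed values are minus those of a
    measure.\<close>
  show "nonpositive_on (points rho_plane) (null_measure borel, rho_curvature)"
    by (simp add: nonpositive_on_def signed_value_def measure_def)
  fix r :: real assume r: "0 < r"
  have "0 < sinh r" using r by simp
  moreover have "measure rho_area (disc rho_plane 0 r) \<le> 32768 * sinh r"
    unfolding measure_def using emeasure_rho_area_disc_le[OF r] r by (intro enn2real_leI) auto
  moreover have "signed_value (null_measure borel, rho_curvature) (disc rho_plane 0 r) = - measure rho_curvature (disc rho_plane 0 r)"
    by (simp add: signed_value_def measure_def)
  \<comment> \<open>The constant is that of the area bound: area divided by 32768 is at most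
    \<open>sinh r\<close>, strictly below \<open>4 * sinh r\<close>.\<close>
  ultimately show "signed_value (null_measure borel, rho_curvature) (disc rho_plane 0 r)
      < - (1 / 32768) * measure rho_area (disc rho_plane 0 r)"
    using measure_rho_curvature_disc_ge[OF r] by linarith
qed (simp_all add: rho.riemann_surface_plane rho.conformal_length_element_plane
    rho.parabolic_plane curvature_measure_rho_plane complete_rho_plane)

end
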